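(* Let $\xi$ be a white noise in a real separable Hilbert space $H$, defined on a probability space $(\Omega,\mathcal{F},\mathbb{P})$ with $\mathcal{F}=\sigma(\xi)$, and let $I$ be the extended stochastic integral. Any $\alpha\in L^2(\Omega,\mathcal{F},\mathbb{P})$ can be written in the form $$\alpha=\mathbb{E}\alpha+Iu$$ for some $u$ from the domain of $I$.
   Context: $H$ is a real separable Hilbert space with scalar product $(\cdot,\cdot)$ and norm $|\cdot|$. A white noise $\xi$ in $H$ is a family $\{(\xi,h),h\in H\}$ of random variables such that each $(\xi,h)$ is Gaussian with mean $0$ and variance $|h|^2$ and $h\mapsto(\xi,h)$ is linear from $H$ to $L^2(\Omega,\mathcal{F},\mathbb{P})$. Itô–Wiener expansion: $H^{\otimes n}_s$ is the Hilbert space of symmetric $n$-linear Hilbert–Schmidt forms on $H$ with norm $\|A_n\|_n^2=\sum_{k_1,\dots,k_n}A_n(e_{k_1},\dots,e_{k_n})^2$, $(e_k)$ an orthonormal basis of $H$. For $A_n=\sum a_{k_1,\dots,k_n}e_{k_1}\otimes\dots\otimes e_{k_n}\in H_s^{\otimes n}$ put $A_n(\xi,\dots,\xi)=\sum_{j_1+j_2+\dots=n}b_{j_1,j_2,\dots}\prod_l H_{j_l}((\xi,e_l))$, where $b_{j_1,j_2,\dots}=\frac{n!}{j_1!j_2!\cdots}a_{1,\dots,1,2,\dots,2,\dots}$ (index $l$ repeated $j_l$ times) and $H_k(x)=(-1)^ke^{x^2/2}(d/dx)^ke^{-x^2/2}$. Then $\mathbb{E}A_n(\xi,\dots,\xi)^2=n!\|A_n\|_n^2$,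 polynomials of different degrees are orthogonal, and each $\alpha\in L^2(\Omega,\sigma(\xi),\mathbb{P})$ is uniquely $\alpha=\sum_{n\ge0}A_n(\xi,\dots,\xi)$ with $A_n\in H_s^{\otimes n}$. Stochastic derivative: $\alpha=\sum_nA_n(\xi,\dots,\xi)$ is stochastically differentiable if there is $D\alpha\in L^2(\Omega,\sigma(\xi),\mathbb{P};H)$ such that for every $h\in H$, $(D\alpha,h)=\sum_{n}nA_n(h,\xi,\dots,\xi)$ ($n-1$ copies of $\xi$). $D$ is an unbounded closed operator from $L^2(\Omega,\sigma(\xi),\mathbb{P})$ to $L^2(\Omega,\sigma(\xi),\mathbb{P};H)$. The extended stochastic integral is the adjoint operator $I=D^*$. *)

theory Defs
  imports "HOL-Probability.Probability" "HOL-Library.Multiset"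
begin

text \<open>
  The separable Hilbert space is a type of sort \<open>{real_inner, polish_space}\<close>: complete and second
  countable, of finite or infinite dimension. Elements of L2 are represented by
  functions, so equality in L2 is equality almost everywhere, and objects that the mathematics
  determines only as L2 classes (the limit of a series, the stochastic derivative and integral)
  are given as relations that hold for every version of the object.
\<close>

definition square_integrable :: "'a measure \<Rightarrow> ('a \<Rightarrow> 'b::real_normed_vector) \<Rightarrow> bool" where
  "square_integrable M X \<longleftrightarrow> X \<in> borel_measurable M \<and> integrable M (\<lambda>\<omega>. (norm (X \<omega>))\<^sup>2)"

definition L2_has_sum :: "'a measure \<Rightarrow> ('k \<Rightarrow> 'a \<Rightarrow> real) \<Rightarrow> 'k set \<Rightarrow> ('a \<Rightarrow> real) \<Rightarrow> bool" where
  "L2_has_sum M f K X \<longleftrightarrow>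
     square_integrable M X \<and> (\<forall>k\<in>K. square_integrable M (f k)) \<and>
     ((\<lambda>F. \<integral>\<omega>. (X \<omega> - (\<Sum>k\<in>F. f k \<omega>))\<^sup>2 \<partial>M) \<longlongrightarrow> 0) (finite_subsets_at_top K)"

text \<open>Centred Gaussian law with standard deviation \<open>s\<close>; degenerate for \<open>s = 0\<close>.\<close>

definition centred_gaussian :: "real \<Rightarrow> real measure" where
  "centred_gaussian s =
     (if s = 0 then return borel 0 else density lborel (\<lambda>x. ennreal (normal_density 0 s x)))"

definition white_noise ::
    "'a measure \<Rightarrow> ('h::{real_inner, polish_space} \<Rightarrow> 'a \<Rightarrow> real) \<Rightarrow> bool" where
  "white_noise M \<xi> \<longleftrightarrow>
     (\<forall>h. \<xi> h \<in> borel_measurable M \<and> distr M borel (\<xi> h) = centred_gaussian (norm h)) \<and>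
     (\<forall>a b h k. AE \<omega> in M. \<xi> (a *\<^sub>R h + b *\<^sub>R k) \<omega> = a * \<xi> h \<omega> + b * \<xi> k \<omega>)"

definition noise_sigma_algebra :: "'a measure \<Rightarrow> ('h \<Rightarrow> 'a \<Rightarrow> real) \<Rightarrow> 'a set set" where
  "noise_sigma_algebra M \<xi> = sigma_sets (space M) {\<xi> h -` B \<inter> space M | h B. B \<in> sets borel}"

text \<open>
  The basis is \<open>(e k)\<close>, \<open>k \<in> J\<close>. An index set \<open>J\<close> of natural numbers accommodates every dimension.
\<close>

definition orthonormal_basis :: "(nat \<Rightarrow> 'h::real_inner) \<Rightarrow> nat set \<Rightarrow> bool" where
  "orthonormal_basis e J \<longleftrightarrow>
     (\<forall>i\<in>J. \<forall>j\<in>J. e i \<bullet> e j = (if i = j then 1 else 0)) \<and> closure (span (e ` J)) = UNIV"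

text \<open>
  An \<open>n\<close>-linear form is a function on lists, of which only the values on lists of length \<open>n\<close>
  matter. Continuity in each argument has to be demanded: linearity and the sum over the basis alone
  do not exclude discontinuous forms that vanish on the basis.
\<close>

definition symmetric_HS_form ::
    "(nat \<Rightarrow> 'h::real_inner) \<Rightarrow> nat set \<Rightarrow> nat \<Rightarrow> ('h list \<Rightarrow> real) \<Rightarrow> bool" where
  "symmetric_HS_form e J n A \<longleftrightarrow>
     (\<forall>xs i. length xs = n \<longrightarrow> i < n \<longrightarrow> bounded_linear (\<lambda>h. A (xs[i := h]))) \<and>
     (\<forall>xs ys. length xs = n \<longrightarrow> mset xs = mset ys \<longrightarrow> A xs = A ys) \<and>
     (\<lambda>ks. (A (map e ks))\<^sup>2) summable_on {ks. length ks = n \<and> set ks \<subseteq> J}"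

definition hermite :: "nat \<Rightarrow> real \<Rightarrow> real" where
  "hermite k x = (-1) ^ k * exp (x\<^sup>2 / 2) * (deriv ^^ k) (\<lambda>t. exp (- (t\<^sup>2 / 2))) x"

text \<open>
  \<open>X\<close> is a version of \<open>A(\<xi>, \<dots>, \<xi>)\<close>. A multi-index \<open>(j\<^sub>l)\<close> with sum \<open>n\<close> is a multiset \<open>m\<close> of
  indices of size \<open>n\<close>, with \<open>j\<^sub>l = count m l\<close>; its sorted list is \<open>1, \<dots>, 1, 2, \<dots>, 2, \<dots>\<close>.
\<close>

definition noise_polynomial ::
    "'a measure \<Rightarrow> ('h::{real_inner, polish_space} \<Rightarrow> 'a \<Rightarrow> real) \<Rightarrow> (nat \<Rightarrow> 'h) \<Rightarrow> nat set \<Rightarrow>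
     nat \<Rightarrow> ('h list \<Rightarrow> real) \<Rightarrow> ('a \<Rightarrow> real) \<Rightarrow> bool" where
  "noise_polynomial M \<xi> e J n A X \<longleftrightarrow>
     L2_has_sum M
       (\<lambda>m \<omega>. fact n / (\<Prod>l\<in>set_mset m. fact (count m l))
               * A (map e (sorted_list_of_multiset m))
               * (\<Prod>l\<in>set_mset m. hermite (count m l) (\<xi> (e l) \<omega>)))
       {m. size m = n \<and> set_mset m \<subseteq> J} X"

definition ito_wiener_expansion ::
    "'a measure \<Rightarrow> ('h::{real_inner, polish_space} \<Rightarrow> 'a \<Rightarrow> real) \<Rightarrow> (nat \<Rightarrow> 'h) \<Rightarrow> nat set \<Rightarrow>
     (nat \<Rightarrow> 'h list \<Rightarrow> real) \<Rightarrow> ('a \<Rightarrow> real) \<Rightarrow> bool" where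
  "ito_wiener_expansion M \<xi> e J A \<alpha> \<longleftrightarrow>
     (\<forall>n. symmetric_HS_form e J n (A n)) \<and>
     (\<exists>P. (\<forall>n. noise_polynomial M \<xi> e J n (A n) (P n)) \<and> L2_has_sum M P UNIV \<alpha>)"

text \<open>
  \<open>\<alpha>\<close> is stochastically differentiable and \<open>Z\<close> is a version of \<open>D \<alpha>\<close>. The sum over \<open>n\<close> of
  \<open>n A\<^sub>n(h, \<xi>, \<dots>, \<xi>)\<close> is shifted by one, since its term for \<open>n = 0\<close> vanishes.
\<close>

definition has_stochastic_derivative ::
    "'a measure \<Rightarrow> ('h::{real_inner, polish_space} \<Rightarrow> 'a \<Rightarrow> real) \<Rightarrow> (nat \<Rightarrow> 'h) \<Rightarrow> nat set \<Rightarrow>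
     ('a \<Rightarrow> real) \<Rightarrow> ('a \<Rightarrow> 'h) \<Rightarrow> bool" where
  "has_stochastic_derivative M \<xi> e J \<alpha> Z \<longleftrightarrow>
     square_integrable M Z \<and>
     (\<exists>A. ito_wiener_expansion M \<xi> e J A \<alpha> \<and>
       (\<forall>h. \<exists>Q. (\<forall>n. noise_polynomial M \<xi> e J n (\<lambda>xs. A (Suc n) (h # xs)) (Q n)) \<and>
                L2_has_sum M (\<lambda>n \<omega>. real (Suc n) * Q n \<omega>) UNIV (\<lambda>\<omega>. Z \<omega> \<bullet> h)))"

text \<open>
  The graph of the adjoint of \<open>D\<close>: \<open>u\<close> belongs to the domain of the extended stochastic integral
  \<open>I\<close> and \<open>\<beta>\<close> is a version of \<open>I u\<close>.
\<close>

definition has_extended_stochastic_integral ::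
    "'a measure \<Rightarrow> ('h::{real_inner, polish_space} \<Rightarrow> 'a \<Rightarrow> real) \<Rightarrow> (nat \<Rightarrow> 'h) \<Rightarrow> nat set \<Rightarrow>
     ('a \<Rightarrow> 'h) \<Rightarrow> ('a \<Rightarrow> real) \<Rightarrow> bool" where
  "has_extended_stochastic_integral M \<xi> e J u \<beta> \<longleftrightarrow>
     square_integrable M u \<and> square_integrable M \<beta> \<and>
     (\<forall>\<alpha> Z. has_stochastic_derivative M \<xi> e J \<alpha> Z \<longrightarrow>
        (\<integral>\<omega>. \<alpha> \<omega> * \<beta> \<omega> \<partial>M) = (\<integral>\<omega>. Z \<omega> \<bullet> u \<omega> \<partial>M))"

end

theory Submission imports Defs begin

text \<open>
  Write \<open>\<phi>\<^sub>m\<close> for the product of the Hermite polynomials \<open>H\<^bsub>m\<^sub>l\<^esub>(\<xi>(e\<^sub>l))\<close>, for a multiset \<open>m\<close> of basis indices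
  with multiplicities \<open>m\<^sub>l\<close>. The extended stochastic integral raises the degree by one: the adjoint
  relation that defines it gives \<open>I(\<phi>\<^sub>m e\<^sub>k) = \<phi>\<^bsub>m+k\<^esub>\<close>. So every \<open>\<phi>\<^sub>m\<close> with \<open>m\<close> nonempty is an integral: remove
  any one index \<open>k\<close> from \<open>m\<close>. Put \<open>\<beta> = \<alpha> - E \<alpha>\<close>, let \<open>c\<^sub>m = E(\<phi>\<^sub>m \<beta>) / m!\<close>, where \<open>m!\<close> is the product of the
  factorials of the multiplicities, and take

    \<open>u = (\<Sum>m\<noteq>0. c\<^sub>m \<phi>\<^bsub>m-k(m)\<^esub> e\<^bsub>k(m)\<^esub>)\<close>.

  The summands are orthogonal, because \<open>m\<close> can be recovered from \<open>m - k(m)\<close> and \<open>k(m)\<close>, and their squared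
  norms \<open>c\<^sub>m\<^sup>2 (m - k(m))!\<close> are at most the squared norms \<open>c\<^sub>m\<^sup>2 m!\<close> of the summands of \<open>\<Sum>m. c\<^sub>m \<phi>\<^sub>m\<close>, whose
  sum Bessel's inequality bounds by \<open>E \<beta>\<^sup>2\<close>. Hence \<open>u\<close> exists in L2.

  Two facts carry the argument.

  \<^item> \<open>E(\<phi>\<^sub>m \<phi>\<^sub>p) = m!\<close> if \<open>m = p\<close>, and \<open>0\<close> otherwise (\<open>integral_hermite_product_mult\<close>). White noise is
    specified by its linearity and its one-dimensional laws, so the mixed moments have to be extracted from them. The
    tool is Gaussian integration by parts, \<open>E(\<xi>(a) F) = E(\<partial>\<^sub>a F)\<close> for polynomials \<open>F\<close> in the noise, which
    follows from the moments of \<open>\<xi>(h + s g)\<close> by differentiating in \<open>s\<close> at \<open>0\<close> (polarization).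

  \<^item> If \<open>\<gamma>\<close> has the stochastic derivative \<open>Z\<close>, then \<open>E((Z, e\<^sub>k) \<phi>\<^sub>m) = E(\<gamma> \<phi>\<^bsub>m+k\<^esub>)\<close>
    (\<open>stochastic_derivative_coefficient\<close>): both sides equal \<open>(n + 1)!\<close> times the same coefficient of
    the form of degree \<open>n + 1\<close>, where \<open>n\<close> is the size of \<open>m\<close>.

  By the second fact \<open>E(Z, u) = E(\<gamma> \<beta>')\<close> for the chaos projection \<open>\<beta>' = (\<Sum>m. c\<^sub>m \<phi>\<^sub>m)\<close> of \<open>\<beta>\<close>, and
  \<open>E(\<gamma> \<beta>') = E(\<gamma> \<beta>)\<close> because \<open>\<gamma>\<close> is a limit of combinations of the \<open>\<phi>\<^sub>m\<close>, to which \<open>\<beta> - \<beta>'\<close> is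
  orthogonal.
\<close>

section \<open>Square integrable functions with values in a Hilbert space\<close>

lemma square_integrable_real_iff:
  fixes X :: "'a \<Rightarrow> real"
  shows "square_integrable M X \<longleftrightarrow> X \<in> borel_measurable M \<and> integrable M (\<lambda>\<omega>. (X \<omega>)\<^sup>2)"
  by (simp add: square_integrable_def)

context
  fixes M :: "'a measure"
begin

lemma square_integrable_inner:
  fixes f g :: "'a \<Rightarrow> 'h::{real_inner, second_countable_topology}"
  assumes "square_integrable M f" "square_integrable M g"
  shows "integrable M (\<lambda>\<omega>. f \<omega> \<bullet> g \<omega>)"
proof (rule Bochner_Integration.integrable_bound)
  show "integrable M (\<lambda>\<omega>. (norm (f \<omega>))\<^sup>2 + (norm (g \<omega>))\<^sup>2)"
    using assms by (simp add: square_integrable_def)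
  show "(\<lambda>\<omega>. f \<omega> \<bullet> g \<omega>) \<in> borel_measurable M"
    using assms by (auto simp: square_integrable_def)
  have "\<bar>x \<bullet> y\<bar> \<le> (norm x)\<^sup>2 + (norm y)\<^sup>2" for x y :: 'h
  proof -
    have "\<bar>x \<bullet> y\<bar> \<le> norm x * norm y" by (rule Cauchy_Schwarz_ineq2)
    also have "\<dots> \<le> (norm x)\<^sup>2 + (norm y)\<^sup>2"
      using sum_squares_bound[of "norm x" "norm y"] mult_nonneg_nonneg[of "norm x" "norm y"]
      unfolding mult.assoc by (smt (verit) norm_ge_zero)
    finally show ?thesis .
  qed
  then show "AE \<omega> in M. norm (f \<omega> \<bullet> g \<omega>) \<le> norm ((norm (f \<omega>))\<^sup>2 + (norm (g \<omega>))\<^sup>2)"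
    by simp
qed

lemma square_integrable_mult:
  fixes f g :: "'a \<Rightarrow> real"
  assumes "square_integrable M f" "square_integrable M g"
  shows "integrable M (\<lambda>\<omega>. f \<omega> * g \<omega>)"
  using square_integrable_inner[OF assms] by simp

lemma square_integrable_scaleR:
  fixes f :: "'a \<Rightarrow> 'h::{real_inner, second_countable_topology}"
  assumes "square_integrable M f"
  shows "square_integrable M (\<lambda>\<omega>. c *\<^sub>R f \<omega>)"
  using assms
  by (auto simp: square_integrable_def power_mult_distrib intro!: borel_measurable_scaleR)

lemma square_integrable_add:
  fixes f g :: "'a \<Rightarrow> 'h::{real_inner, second_countable_topology}"
  assumes "square_integrable M f" "square_integrable M g"
  shows "square_integrable M (\<lambda>\<omega>. f \<omega> + g \<omega>)"
proof -
  have "integrable M (\<lambda>\<omega>. (norm (f \<omega>))\<^sup>2 + 2 * (f \<omega> \<bullet> g \<omega>) + (norm (g \<omega>))\<^sup>2)"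
    using assms square_integrable_inner[OF assms]
    by (intro Bochner_Integration.integrable_add) (auto simp: square_integrable_def)
  moreover have "(norm (x + y))\<^sup>2 = (norm x)\<^sup>2 + 2 * (x \<bullet> y) + (norm y)\<^sup>2" for x y :: 'h
    by (simp add: power2_norm_eq_inner inner_add inner_commute)
  ultimately show ?thesis using assms by (auto simp: square_integrable_def)
qed

lemma square_integrable_diff:
  fixes f g :: "'a \<Rightarrow> 'h::{real_inner, second_countable_topology}"
  assumes "square_integrable M f" "square_integrable M g"
  shows "square_integrable M (\<lambda>\<omega>. f \<omega> - g \<omega>)"
  using square_integrable_add[OF assms(1) square_integrable_scaleR[OF assms(2), of "-1"]] by simp

lemma square_integrable_zero: "square_integrable M (\<lambda>\<omega>. 0)"
  by (simp add: square_integrable_def)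

lemma square_integrable_sum:
  fixes f :: "'k \<Rightarrow> 'a \<Rightarrow> 'h::{real_inner, second_countable_topology}"
  assumes "\<And>i. i \<in> F \<Longrightarrow> square_integrable M (f i)"
  shows "square_integrable M (\<lambda>\<omega>. \<Sum>i\<in>F. f i \<omega>)"
  using assms
  by (induction F rule: infinite_finite_induct)
    (auto intro: square_integrable_zero square_integrable_add)

lemma integral_inner_Cauchy_Schwarz:
  fixes f g :: "'a \<Rightarrow> 'h::{real_inner, second_countable_topology}"
  assumes f: "square_integrable M f" and g: "square_integrable M g"
  shows "(\<integral>\<omega>. f \<omega> \<bullet> g \<omega> \<partial>M)\<^sup>2 \<le> (\<integral>\<omega>. (norm (f \<omega>))\<^sup>2 \<partial>M) * (\<integral>\<omega>. (norm (g \<omega>))\<^sup>2 \<partial>M)"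
proof -
  define A B c where "A = (\<integral>\<omega>. (norm (f \<omega>))\<^sup>2 \<partial>M)" and "B = (\<integral>\<omega>. (norm (g \<omega>))\<^sup>2 \<partial>M)"
    and "c = (\<integral>\<omega>. f \<omega> \<bullet> g \<omega> \<partial>M)"
  have fg: "integrable M (\<lambda>\<omega>. f \<omega> \<bullet> g \<omega>)" by (rule square_integrable_inner[OF f g])
  have f2: "integrable M (\<lambda>\<omega>. (norm (f \<omega>))\<^sup>2)" and g2: "integrable M (\<lambda>\<omega>. (norm (g \<omega>))\<^sup>2)"
    using f g by (auto simp: square_integrable_def)
  have "B \<ge> 0" by (simp add: B_def)
  show ?thesis
  proof (cases "B = 0")
    case True
    then have "AE \<omega> in M. g \<omega> = 0"
      using integral_nonneg_eq_0_iff_AE[OF g2] by (simp add: B_def)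
    then have "AE \<omega> in M. f \<omega> \<bullet> g \<omega> = 0" by eventually_elim simp
    then have "c = 0" unfolding c_def by (rule integral_eq_zero_AE)
    with True show ?thesis by (simp add: A_def B_def c_def)
  next
    case False
    \<comment> \<open>\<open>B f - c g\<close> is \<open>B\<close> times the component of \<open>f\<close> orthogonal to \<open>g\<close>.\<close>
    have "0 \<le> (\<integral>\<omega>. (norm (B *\<^sub>R f \<omega> - c *\<^sub>R g \<omega>))\<^sup>2 \<partial>M)" by simp
    also have "(\<lambda>\<omega>. (norm (B *\<^sub>R f \<omega> - c *\<^sub>R g \<omega>))\<^sup>2)
        = (\<lambda>\<omega>. B\<^sup>2 * (norm (f \<omega>))\<^sup>2 - 2 * B * c * (f \<omega> \<bullet> g \<omega>) + c\<^sup>2 * (norm (g \<omega>))\<^sup>2)"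
      by (simp only: power2_norm_eq_inner) (simp add: inner_diff inner_commute power2_eq_square algebra_simps)
    also have "(\<integral>\<omega>. B\<^sup>2 * (norm (f \<omega>))\<^sup>2 - 2 * B * c * (f \<omega> \<bullet> g \<omega>) + c\<^sup>2 * (norm (g \<omega>))\<^sup>2 \<partial>M)
        = B\<^sup>2 * A - 2 * B * c * c + c\<^sup>2 * B"
      using f2 g2 fg by (simp add: A_def B_def c_def)
    also have "\<dots> = B * (A * B - c\<^sup>2)" by (simp add: power2_eq_square algebra_simps)
    finally have "A * B - c\<^sup>2 \<ge> 0" using False \<open>B \<ge> 0\<close> by (simp add: zero_le_mult_iff)
    then show ?thesis by (simp add: A_def B_def c_def)
  qed
qed

lemma tendsto_integral_inner:
  fixes Z X :: "'a \<Rightarrow> 'h::{real_inner, second_countable_topology}"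
  assumes Z: "square_integrable M Z" and X: "square_integrable M X"
    and S: "\<forall>\<^sub>F i in F. square_integrable M (S i)"
    and lim: "((\<lambda>i. \<integral>\<omega>. (norm (X \<omega> - S i \<omega>))\<^sup>2 \<partial>M) \<longlongrightarrow> 0) F"
  shows "((\<lambda>i. \<integral>\<omega>. Z \<omega> \<bullet> S i \<omega> \<partial>M) \<longlongrightarrow> (\<integral>\<omega>. Z \<omega> \<bullet> X \<omega> \<partial>M)) F"
proof -
  define d where "d i = (\<integral>\<omega>. Z \<omega> \<bullet> X \<omega> \<partial>M) - (\<integral>\<omega>. Z \<omega> \<bullet> S i \<omega> \<partial>M)" for i
  have bd: "(d i)\<^sup>2 \<le> (\<integral>\<omega>. (norm (Z \<omega>))\<^sup>2 \<partial>M) * (\<integral>\<omega>. (norm (X \<omega> - S i \<omega>))\<^sup>2 \<partial>M)"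
    if "square_integrable M (S i)" for i
  proof -
    have "d i = (\<integral>\<omega>. Z \<omega> \<bullet> (X \<omega> - S i \<omega>) \<partial>M)"
      using square_integrable_inner[OF Z X] square_integrable_inner[OF Z that]
      by (simp add: d_def inner_diff_right)
    then show ?thesis
      using integral_inner_Cauchy_Schwarz[OF Z square_integrable_diff[OF X that]] by simp
  qed
  have bound_lim: "((\<lambda>i. (\<integral>\<omega>. (norm (Z \<omega>))\<^sup>2 \<partial>M) * (\<integral>\<omega>. (norm (X \<omega> - S i \<omega>))\<^sup>2 \<partial>M)) \<longlongrightarrow> 0) F"
    using tendsto_mult_right_zero[OF lim] by simp
  have "((\<lambda>i. (d i)\<^sup>2) \<longlongrightarrow> 0) F"
    by (rule tendsto_sandwich[OF _ eventually_mono[OF S bd] tendsto_const bound_lim]) auto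
  then have "(d \<longlongrightarrow> 0) F" by (simp add: power_tendsto_0_iff)
  then have "((\<lambda>i. (\<integral>\<omega>. Z \<omega> \<bullet> X \<omega> \<partial>M) - d i) \<longlongrightarrow> (\<integral>\<omega>. Z \<omega> \<bullet> X \<omega> \<partial>M) - 0) F"
    by (intro tendsto_intros)
  then show ?thesis by (simp add: d_def)
qed

lemma L2_has_sum_integral_mult:
  assumes "L2_has_sum M f K X" and Z: "square_integrable M Z"
  shows "((\<lambda>k. \<integral>\<omega>. Z \<omega> * f k \<omega> \<partial>M) has_sum (\<integral>\<omega>. Z \<omega> * X \<omega> \<partial>M)) K"
proof -
  have f: "\<And>k. k \<in> K \<Longrightarrow> square_integrable M (f k)" and X: "square_integrable M X"
    and lim: "((\<lambda>F. \<integral>\<omega>. (X \<omega> - (\<Sum>k\<in>F. f k \<omega>))\<^sup>2 \<partial>M) \<longlongrightarrow> 0) (finite_subsets_at_top K)"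
    using assms(1) by (auto simp: L2_has_sum_def)
  have "((\<lambda>F. \<integral>\<omega>. Z \<omega> \<bullet> (\<Sum>k\<in>F. f k \<omega>) \<partial>M) \<longlongrightarrow> (\<integral>\<omega>. Z \<omega> \<bullet> X \<omega> \<partial>M)) (finite_subsets_at_top K)"
    using lim f
    by (intro tendsto_integral_inner[OF Z X])
      (auto intro!: eventually_finite_subsets_at_top_weakI square_integrable_sum)
  moreover have "(\<integral>\<omega>. Z \<omega> \<bullet> (\<Sum>k\<in>F. f k \<omega>) \<partial>M) = (\<Sum>k\<in>F. \<integral>\<omega>. Z \<omega> * f k \<omega> \<partial>M)"
    if "finite F" "F \<subseteq> K" for F
  proof -
    have "(\<integral>\<omega>. Z \<omega> \<bullet> (\<Sum>k\<in>F. f k \<omega>) \<partial>M) = (\<integral>\<omega>. (\<Sum>k\<in>F. Z \<omega> * f k \<omega>) \<partial>M)"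
      by (simp add: sum_distrib_left)
    also have "\<dots> = (\<Sum>k\<in>F. \<integral>\<omega>. Z \<omega> * f k \<omega> \<partial>M)"
      using that f by (intro Bochner_Integration.integral_sum) (auto intro!: square_integrable_mult Z)
    finally show ?thesis .
  qed
  ultimately show ?thesis
    unfolding has_sum_def
    by (auto elim!: Lim_transform_eventually intro!: eventually_finite_subsets_at_top_weakI)
qed

lemma integral_norm_sum_orthogonal:
  fixes g :: "'k \<Rightarrow> 'a \<Rightarrow> 'h::{real_inner, second_countable_topology}"
  assumes "finite F"
    and g: "\<And>i. square_integrable M (g i)"
    and orth: "\<And>i j. i \<noteq> j \<Longrightarrow> (\<integral>\<omega>. g i \<omega> \<bullet> g j \<omega> \<partial>M) = 0"
  shows "(\<integral>\<omega>. (norm (\<Sum>i\<in>F. g i \<omega>))\<^sup>2 \<partial>M) = (\<Sum>i\<in>F. \<integral>\<omega>. (norm (g i \<omega>))\<^sup>2 \<partial>M)"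
  using assms(1)
proof (induction F rule: finite_induct)
  case (insert i F)
  have G: "square_integrable M (\<lambda>\<omega>. \<Sum>i\<in>F. g i \<omega>)" by (intro square_integrable_sum g)
  have [simp]: "integrable M (\<lambda>\<omega>. g i \<omega> \<bullet> g j \<omega>)" for j by (intro square_integrable_inner g)
  have z: "(\<integral>\<omega>. g i \<omega> \<bullet> (\<Sum>i\<in>F. g i \<omega>) \<partial>M) = 0"
    using insert.hyps by (auto simp: inner_sum_right intro!: sum.neutral orth)
  have "(\<integral>\<omega>. (norm (\<Sum>i\<in>insert i F. g i \<omega>))\<^sup>2 \<partial>M)
      = (\<integral>\<omega>. (norm (g i \<omega>))\<^sup>2 + 2 * (g i \<omega> \<bullet> (\<Sum>i\<in>F. g i \<omega>)) + (norm (\<Sum>i\<in>F. g i \<omega>))\<^sup>2 \<partial>M)"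
    using insert.hyps by (simp only: power2_norm_eq_inner) (simp add: inner_add inner_commute algebra_simps)
  also have "\<dots> = (\<integral>\<omega>. (norm (g i \<omega>))\<^sup>2 \<partial>M) + 2 * 0 + (\<integral>\<omega>. (norm (\<Sum>i\<in>F. g i \<omega>))\<^sup>2 \<partial>M)"
    using g[of i] G square_integrable_inner[OF g[of i] G]
    by (subst Bochner_Integration.integral_add)
      (auto simp: square_integrable_def z simp del: inner_sum_right)
  finally show ?case using insert by simp
qed simp

text \<open>
  The hypothesis \<open>proj\<close> says that every \<open>g i\<close> is the projection of \<open>f\<close> to the line that it spans.
\<close>

lemma Bessel_summable:
  fixes g :: "nat \<Rightarrow> 'a \<Rightarrow> 'h::{real_inner, second_countable_topology}"
  assumes f: "square_integrable M f"
    and g: "\<And>i. square_integrable M (g i)"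
    and orth: "\<And>i j. i \<noteq> j \<Longrightarrow> (\<integral>\<omega>. g i \<omega> \<bullet> g j \<omega> \<partial>M) = 0"
    and proj: "\<And>i. (\<integral>\<omega>. f \<omega> \<bullet> g i \<omega> \<partial>M) = (\<integral>\<omega>. (norm (g i \<omega>))\<^sup>2 \<partial>M)"
  shows "summable (\<lambda>i. \<integral>\<omega>. (norm (g i \<omega>))\<^sup>2 \<partial>M)"
proof (rule bounded_imp_summable)
  fix n
  define a where "a = (\<Sum>i\<le>n. \<integral>\<omega>. (norm (g i \<omega>))\<^sup>2 \<partial>M)"
  define S where "S \<omega> = (\<Sum>i\<le>n. g i \<omega>)" for \<omega>
  have S: "square_integrable M S" unfolding S_def by (intro square_integrable_sum g)
  have SS: "(\<integral>\<omega>. (norm (S \<omega>))\<^sup>2 \<partial>M) = a"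
    unfolding S_def a_def by (rule integral_norm_sum_orthogonal[OF _ g orth]) auto
  have fS: "(\<integral>\<omega>. f \<omega> \<bullet> S \<omega> \<partial>M) = a"
    unfolding S_def a_def inner_sum_right
    using square_integrable_inner[OF f g] by (simp add: proj)
  have "0 \<le> (\<integral>\<omega>. (norm (f \<omega> - S \<omega>))\<^sup>2 \<partial>M)" by simp
  also have "(\<lambda>\<omega>. (norm (f \<omega> - S \<omega>))\<^sup>2) = (\<lambda>\<omega>. (norm (f \<omega>))\<^sup>2 - 2 * (f \<omega> \<bullet> S \<omega>) + (norm (S \<omega>))\<^sup>2)"
    by (simp only: power2_norm_eq_inner) (simp add: inner_diff inner_commute algebra_simps)
  also have "(\<integral>\<omega>. (norm (f \<omega>))\<^sup>2 - 2 * (f \<omega> \<bullet> S \<omega>) + (norm (S \<omega>))\<^sup>2 \<partial>M)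
      = (\<integral>\<omega>. (norm (f \<omega>))\<^sup>2 \<partial>M) - 2 * a + a"
    using f S square_integrable_inner[OF f S] by (simp add: square_integrable_def fS SS)
  finally show "(\<Sum>i\<le>n. \<integral>\<omega>. (norm (g i \<omega>))\<^sup>2 \<partial>M) \<le> (\<integral>\<omega>. (norm (f \<omega>))\<^sup>2 \<partial>M)"
    by (simp add: a_def)
qed simp

end

context prob_space begin

text \<open>
  The Riesz-Fischer argument. Along a fast subsequence \<open>r\<close> the increments are summable in L1, so the
  subsequence converges almost everywhere by completeness of the Hilbert space, and Fatou's lemma
  turns the pointwise limit into an L2 limit of the whole sequence.
\<close>

lemma L2_complete:
  fixes S :: "nat \<Rightarrow> 'a \<Rightarrow> 'h::{real_inner, polish_space}"
  assumes S: "\<And>n. square_integrable M (S n)"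
    and cauchy: "\<And>\<epsilon>. \<epsilon> > 0 \<Longrightarrow> \<exists>N. \<forall>m\<ge>N. \<forall>n\<ge>N. (\<integral>\<omega>. (norm (S m \<omega> - S n \<omega>))\<^sup>2 \<partial>M) \<le> \<epsilon>"
  shows "\<exists>u. square_integrable M u \<and> (\<lambda>n. \<integral>\<omega>. (norm (u \<omega> - S n \<omega>))\<^sup>2 \<partial>M) \<longlonglongrightarrow> 0"
proof -
  have S_meas[measurable]: "S n \<in> borel_measurable M" for n
    using S by (auto simp: square_integrable_def)
  have SS: "square_integrable M (\<lambda>\<omega>. S m \<omega> - S n \<omega>)" for m n
    by (intro square_integrable_diff S)
  have "\<forall>k. \<exists>N. \<forall>m\<ge>N. \<forall>n\<ge>N. (\<integral>\<omega>. (norm (S m \<omega> - S n \<omega>))\<^sup>2 \<partial>M) \<le> (1/4) ^ k"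
    by (intro allI cauchy) simp
  then obtain N where N: "\<And>k m n. m \<ge> N k \<Longrightarrow> n \<ge> N k \<Longrightarrow> (\<integral>\<omega>. (norm (S m \<omega> - S n \<omega>))\<^sup>2 \<partial>M) \<le> (1/4) ^ k"
    by metis
  \<comment> \<open>\<open>r\<close> is increasing and dominates \<open>N\<close>; the summand \<open>k\<close> makes it unbounded.\<close>
  define r where "r k = k + (\<Sum>i\<le>k. N i)" for k
  have r_N: "N k \<le> r k" and r_Suc: "r k \<le> r (Suc k)" and r_id: "k \<le> r k" for k
    using member_le_sum[of k "{..k}" N] by (auto simp: r_def)
  \<comment> \<open>The measure being a probability, the L1 norm is at most the L2 norm.\<close>
  have L1: "(\<integral>\<omega>. norm (S (r (Suc k)) \<omega> - S (r k) \<omega>) \<partial>M) \<le> (1/2) ^ k" for k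
  proof -
    let ?d = "\<lambda>\<omega>. norm (S (r (Suc k)) \<omega> - S (r k) \<omega>)"
    have d: "square_integrable M ?d" using SS[of "r (Suc k)" "r k"] by (auto simp: square_integrable_def)
    have "square_integrable M (\<lambda>_. 1::real)" by (simp add: square_integrable_def)
    from integral_inner_Cauchy_Schwarz[OF d this]
    have "(\<integral>\<omega>. ?d \<omega> \<partial>M)\<^sup>2 \<le> (\<integral>\<omega>. (?d \<omega>)\<^sup>2 \<partial>M)" by (simp add: prob_space)
    also have "\<dots> \<le> (1/4) ^ k" using r_N[of k] r_Suc[of k] by (intro N) auto
    also have "\<dots> = ((1/2) ^ k)\<^sup>2" by (simp add: power_mult[symmetric] mult.commute power2_eq_square flip: power_mult_distrib)
    finally show ?thesis by (rule power2_le_imp_le) simp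
  qed
  have int_d: "integrable M (\<lambda>\<omega>. norm (S (r (Suc k)) \<omega> - S (r k) \<omega>))" for k
  proof (rule Bochner_Integration.integrable_bound)
    show "integrable M (\<lambda>\<omega>. 1 + (norm (S (r (Suc k)) \<omega> - S (r k) \<omega>))\<^sup>2)"
      using SS[of "r (Suc k)" "r k"] by (auto simp: square_integrable_def)
    have "t \<le> 1 + t\<^sup>2" for t :: real using sum_squares_bound[of t 1] by (cases "t \<ge> 0") (auto intro: order_trans[of _ 0])
    then show "AE \<omega> in M. norm (norm (S (r (Suc k)) \<omega> - S (r k) \<omega>)) \<le> norm (1 + (norm (S (r (Suc k)) \<omega> - S (r k) \<omega>))\<^sup>2)"
      by simp
  qed auto
  have "(\<integral>\<^sup>+\<omega>. (\<Sum>k. ennreal (norm (S (r (Suc k)) \<omega> - S (r k) \<omega>))) \<partial>M)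
      = (\<Sum>k. \<integral>\<^sup>+\<omega>. ennreal (norm (S (r (Suc k)) \<omega> - S (r k) \<omega>)) \<partial>M)"
    by (rule nn_integral_suminf) simp
  also have "\<dots> \<le> (\<Sum>k. ennreal ((1/2) ^ k))"
  proof (rule suminf_le)
    show "(\<integral>\<^sup>+\<omega>. ennreal (norm (S (r (Suc k)) \<omega> - S (r k) \<omega>)) \<partial>M) \<le> ennreal ((1/2) ^ k)" for k
      using L1[of k] int_d[of k] by (subst nn_integral_eq_integral) (auto intro: ennreal_leI)
  qed auto
  also have "\<dots> = ennreal (\<Sum>k. (1/2) ^ k)"
    by (rule suminf_ennreal2) (auto intro: summable_geometric)
  also have "\<dots> < \<infinity>" by simp
  finally have "(\<integral>\<^sup>+\<omega>. (\<Sum>k. ennreal (norm (S (r (Suc k)) \<omega> - S (r k) \<omega>))) \<partial>M) \<noteq> \<infinity>" by simp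
  then have "AE \<omega> in M. (\<Sum>k. ennreal (norm (S (r (Suc k)) \<omega> - S (r k) \<omega>))) \<noteq> \<infinity>"
    by (intro nn_integral_PInf_AE) auto
  then have conv: "AE \<omega> in M. Cauchy (\<lambda>k. S (r k) \<omega>)"
  proof eventually_elim
    case (elim \<omega>)
    let ?a = "\<lambda>k. norm (S (r (Suc k)) \<omega> - S (r k) \<omega>)"
    have "summable ?a" using elim by (intro summable_suminf_not_top) auto
    then have "Cauchy (\<lambda>n. \<Sum>k<n. ?a k)"
      by (intro convergent_Cauchy) (simp add: summable_iff_convergent)
    moreover have le: "dist (S (r n) \<omega>) (S (r m) \<omega>) \<le> dist (\<Sum>k<n. ?a k) (\<Sum>k<m. ?a k)" if "m \<le> n" for m n
    proof -
      have "S (r n) \<omega> - S (r m) \<omega> = (\<Sum>k=m..<n. S (r (Suc k)) \<omega> - S (r k) \<omega>)"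
        using sum_Suc_diff'[OF that, of "\<lambda>k. S (r k) \<omega>"] by simp
      then have "norm (S (r n) \<omega> - S (r m) \<omega>) \<le> (\<Sum>k=m..<n. ?a k)"
        by (simp add: sum_norm_le)
      also have "\<dots> = (\<Sum>k<n. ?a k) - (\<Sum>k<m. ?a k)"
        using that by (simp add: sum_diff_nat_ivl[of 0 m n, symmetric] atLeast0LessThan flip: atLeast0LessThan)
      finally show ?thesis by (simp add: dist_norm)
    qed
    have "dist (S (r m) \<omega>) (S (r n) \<omega>) \<le> dist (\<Sum>k<m. ?a k) (\<Sum>k<n. ?a k)" for m n
      using le[of m n] le[of n m] by (cases m n rule: linorder_le_cases) (simp_all add: dist_commute)
    ultimately show ?case unfolding Cauchy_def by (meson le_less_trans)
  qed
  \<comment> \<open>The terms are replaced by zero on the null set of divergence, so that the limit exists everywhere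
    and \<open>u\<close> is measurable.\<close>
  define u where "u \<omega> = lim (\<lambda>k. if Cauchy (\<lambda>k. S (r k) \<omega>) then S (r k) \<omega> else 0)" for \<omega>
  have [measurable]: "Measurable.pred M (\<lambda>\<omega>. Cauchy (\<lambda>k. S (r k) \<omega>))"
    unfolding pred_def by (rule sets_Collect_Cauchy) simp
  have u_meas[measurable]: "u \<in> borel_measurable M"
  proof (rule borel_measurable_LIMSEQ_metric)
    show "(\<lambda>\<omega>. if Cauchy (\<lambda>k. S (r k) \<omega>) then S (r k) \<omega> else 0) \<in> borel_measurable M" for k
      by measurable
    show "(\<lambda>k. if Cauchy (\<lambda>k. S (r k) \<omega>) then S (r k) \<omega> else 0) \<longlonglongrightarrow> u \<omega>" for \<omega>
      unfolding u_def
      by (cases "Cauchy (\<lambda>k. S (r k) \<omega>)")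
        (simp_all add: Cauchy_convergent_iff convergent_LIMSEQ_iff[symmetric] convergent_const)
  qed
  have u_lim: "AE \<omega> in M. (\<lambda>k. S (r k) \<omega>) \<longlonglongrightarrow> u \<omega>"
    using conv by eventually_elim (simp add: u_def Cauchy_convergent_iff convergent_LIMSEQ_iff)
  have fatou: "(\<integral>\<^sup>+\<omega>. ennreal ((norm (u \<omega> - S n \<omega>))\<^sup>2) \<partial>M) \<le> ennreal ((1/4) ^ k)" if n: "n \<ge> N k" for n k
  proof -
    have "(\<integral>\<^sup>+\<omega>. ennreal ((norm (u \<omega> - S n \<omega>))\<^sup>2) \<partial>M)
        = (\<integral>\<^sup>+\<omega>. liminf (\<lambda>j. ennreal ((norm (S (r j) \<omega> - S n \<omega>))\<^sup>2)) \<partial>M)"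
    proof (rule nn_integral_cong_AE)
      show "AE \<omega> in M. ennreal ((norm (u \<omega> - S n \<omega>))\<^sup>2) = liminf (\<lambda>j. ennreal ((norm (S (r j) \<omega> - S n \<omega>))\<^sup>2))"
        using u_lim
      proof eventually_elim
        case (elim \<omega>)
        have "(\<lambda>j. ennreal ((norm (S (r j) \<omega> - S n \<omega>))\<^sup>2)) \<longlonglongrightarrow> ennreal ((norm (u \<omega> - S n \<omega>))\<^sup>2)"
          using elim by (intro tendsto_ennrealI tendsto_intros)
        then show ?case by (intro lim_imp_Liminf[symmetric]) auto
      qed
    qed
    also have "\<dots> \<le> liminf (\<lambda>j. \<integral>\<^sup>+\<omega>. ennreal ((norm (S (r j) \<omega> - S n \<omega>))\<^sup>2) \<partial>M)"
      by (rule nn_integral_liminf) simp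
    also have "\<dots> \<le> ennreal ((1/4) ^ k)"
    proof (rule Liminf_le)
      have "(\<integral>\<^sup>+\<omega>. ennreal ((norm (S (r j) \<omega> - S n \<omega>))\<^sup>2) \<partial>M) \<le> ennreal ((1/4) ^ k)" if "j \<ge> N k" for j
      proof -
        have "r j \<ge> N k" using r_id[of j] that by simp
        then show ?thesis
          using SS[of "r j" n] N[of k "r j" n] n
          by (subst nn_integral_eq_integral) (auto simp: square_integrable_def intro: ennreal_leI)
      qed
      then show "\<forall>\<^sub>F j in sequentially. (\<integral>\<^sup>+\<omega>. ennreal ((norm (S (r j) \<omega> - S n \<omega>))\<^sup>2) \<partial>M) \<le> ennreal ((1/4) ^ k)"
        unfolding eventually_sequentially by blast
    qed simp
    finally show ?thesis .
  qed
  have diff: "square_integrable M (\<lambda>\<omega>. u \<omega> - S (N 0) \<omega>)"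
    using fatou[of 0 "N 0"] unfolding square_integrable_def
    by (auto intro!: integrableI_bounded simp: order.strict_trans1[of _ 1])
  have u: "square_integrable M u"
    using square_integrable_add[OF diff S[of "N 0"]] by simp
  have "(\<lambda>n. \<integral>\<omega>. (norm (u \<omega> - S n \<omega>))\<^sup>2 \<partial>M) \<longlonglongrightarrow> 0"
  proof (rule LIMSEQ_I)
    fix \<epsilon> :: real assume "\<epsilon> > 0"
    obtain k where k: "(1/4) ^ k < \<epsilon>" using real_arch_pow_inv[OF \<open>\<epsilon> > 0\<close>, of "1/4"] by auto
    have "norm ((\<integral>\<omega>. (norm (u \<omega> - S n \<omega>))\<^sup>2 \<partial>M) - 0) < \<epsilon>" if "n \<ge> N k" for n
    proof -
      have "integrable M (\<lambda>\<omega>. (norm (u \<omega> - S n \<omega>))\<^sup>2)"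
        using square_integrable_diff[OF u S[of n]] by (simp add: square_integrable_def)
      from nn_integral_eq_integral[OF this] fatou[OF that]
      have "(\<integral>\<omega>. (norm (u \<omega> - S n \<omega>))\<^sup>2 \<partial>M) \<le> (1/4) ^ k" by simp
      with k show ?thesis by simp
    qed
    then show "\<exists>n0. \<forall>n\<ge>n0. norm ((\<integral>\<omega>. (norm (u \<omega> - S n \<omega>))\<^sup>2 \<partial>M) - 0) < \<epsilon>" by blast
  qed
  with u show ?thesis by blast
qed

text \<open>
  The limit is described by its inner products, since that is how the adjoint relation for the
  extended stochastic integral looks at it.
\<close>

lemma orthogonal_series_converges:
  fixes g :: "nat \<Rightarrow> 'a \<Rightarrow> 'h::{real_inner, polish_space}"
  assumes g: "\<And>i. square_integrable M (g i)"
    and orth: "\<And>i j. i \<noteq> j \<Longrightarrow> (\<integral>\<omega>. g i \<omega> \<bullet> g j \<omega> \<partial>M) = 0"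
    and summ: "summable (\<lambda>i. \<integral>\<omega>. (norm (g i \<omega>))\<^sup>2 \<partial>M)"
  shows "\<exists>u. square_integrable M u \<and>
    (\<forall>Z. square_integrable M Z \<longrightarrow> (\<lambda>i. \<integral>\<omega>. Z \<omega> \<bullet> g i \<omega> \<partial>M) sums (\<integral>\<omega>. Z \<omega> \<bullet> u \<omega> \<partial>M))"
proof -
  define S where "S n \<omega> = (\<Sum>i<n. g i \<omega>)" for n \<omega>
  define a where "a i = (\<integral>\<omega>. (norm (g i \<omega>))\<^sup>2 \<partial>M)" for i
  have S: "square_integrable M (S n)" for n
    unfolding S_def by (intro square_integrable_sum g)
  have pyth: "(\<integral>\<omega>. (norm (\<Sum>i\<in>F. g i \<omega>))\<^sup>2 \<partial>M) = (\<Sum>i\<in>F. a i)" if "finite F" for F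
    unfolding a_def using that g orth by (rule integral_norm_sum_orthogonal)
  have diff: "(\<integral>\<omega>. (norm (S m \<omega> - S n \<omega>))\<^sup>2 \<partial>M) = \<bar>(\<Sum>i<m. a i) - (\<Sum>i<n. a i)\<bar>" for m n
  proof -
    have 1: "(\<integral>\<omega>. (norm (S m \<omega> - S n \<omega>))\<^sup>2 \<partial>M) = \<bar>(\<Sum>i<m. a i) - (\<Sum>i<n. a i)\<bar>" if "n \<le> m" for m n
    proof -
      have "S m \<omega> - S n \<omega> = (\<Sum>i=n..<m. g i \<omega>)" for \<omega>
        unfolding S_def using sum_diff_nat_ivl[of 0 n m "\<lambda>i. g i \<omega>"] that by (simp add: atLeast0LessThan)
      moreover have "(\<Sum>i<m. a i) - (\<Sum>i<n. a i) = (\<Sum>i=n..<m. a i)"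
        using sum_diff_nat_ivl[of 0 n m a] that by (simp add: atLeast0LessThan)
      moreover have "(\<Sum>i=n..<m. a i) \<ge> 0" by (intro sum_nonneg) (simp add: a_def)
      ultimately show ?thesis using pyth[of "{n..<m}"] by simp
    qed
    show ?thesis
      using 1[of m n] 1[of n m] by (cases "n \<le> m") (simp_all add: norm_minus_commute abs_minus_commute nle_le)
  qed
  have "Cauchy (\<lambda>n. \<Sum>i<n. a i)"
    using summ unfolding a_def[symmetric] by (intro convergent_Cauchy) (simp add: summable_iff_convergent)
  then have "\<exists>N. \<forall>m\<ge>N. \<forall>n\<ge>N. (\<integral>\<omega>. (norm (S m \<omega> - S n \<omega>))\<^sup>2 \<partial>M) \<le> \<epsilon>" if "\<epsilon> > 0" for \<epsilon>
    using that unfolding diff Cauchy_def dist_real_def by (meson less_imp_le)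
  from L2_complete[OF S this] obtain u where u: "square_integrable M u"
    and lim: "(\<lambda>n. \<integral>\<omega>. (norm (u \<omega> - S n \<omega>))\<^sup>2 \<partial>M) \<longlonglongrightarrow> 0" by blast
  have "(\<lambda>i. \<integral>\<omega>. Z \<omega> \<bullet> g i \<omega> \<partial>M) sums (\<integral>\<omega>. Z \<omega> \<bullet> u \<omega> \<partial>M)" if Z: "square_integrable M Z" for Z
  proof -
    have "(\<lambda>n. \<integral>\<omega>. Z \<omega> \<bullet> S n \<omega> \<partial>M) \<longlonglongrightarrow> (\<integral>\<omega>. Z \<omega> \<bullet> u \<omega> \<partial>M)"
      by (rule tendsto_integral_inner[OF Z u _ lim]) (simp add: S)
    moreover have "(\<integral>\<omega>. Z \<omega> \<bullet> S n \<omega> \<partial>M) = (\<Sum>i<n. \<integral>\<omega>. Z \<omega> \<bullet> g i \<omega> \<partial>M)" for n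
      unfolding S_def inner_sum_right
      by (intro Bochner_Integration.integral_sum square_integrable_inner Z g)
    ultimately show ?thesis by (simp add: sums_def)
  qed
  with u show ?thesis by blast
qed

end

section \<open>Random variables with moments of all orders\<close>

context prob_space begin

text \<open>
  The random variables with all moments form an algebra, which makes every polynomial in the noise
  integrable.
\<close>

definition all_moments :: "('a \<Rightarrow> real) \<Rightarrow> bool" where
  "all_moments X \<longleftrightarrow> X \<in> borel_measurable M \<and> (\<forall>n. integrable M (\<lambda>\<omega>. X \<omega> ^ n))"

lemma integrable_power_mult_power:
  assumes "all_moments X" "all_moments Y"
  shows "integrable M (\<lambda>\<omega>. X \<omega> ^ i * Y \<omega> ^ j)"
proof (rule Bochner_Integration.integrable_bound)
  show "integrable M (\<lambda>\<omega>. X \<omega> ^ (2 * i) + Y \<omega> ^ (2 * j))"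
    using assms by (auto simp: all_moments_def)
  show "(\<lambda>\<omega>. X \<omega> ^ i * Y \<omega> ^ j) \<in> borel_measurable M"
    using assms by (auto simp: all_moments_def)
  have "\<bar>a * b\<bar> \<le> a\<^sup>2 + b\<^sup>2" for a b :: real
    using sum_squares_bound[of "\<bar>a\<bar>" "\<bar>b\<bar>"] mult_nonneg_nonneg[of "\<bar>a\<bar>" "\<bar>b\<bar>"]
    unfolding abs_mult mult.assoc power2_abs by (smt (verit) abs_ge_zero)
  then show "AE \<omega> in M. norm (X \<omega> ^ i * Y \<omega> ^ j) \<le> norm (X \<omega> ^ (2 * i) + Y \<omega> ^ (2 * j))"
    by (auto simp: power_mult mult.commute[of 2] )
qed

lemma all_moments_const: "all_moments (\<lambda>_. c)"
  by (simp add: all_moments_def)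

lemma all_moments_mult:
  "all_moments X \<Longrightarrow> all_moments Y \<Longrightarrow> all_moments (\<lambda>\<omega>. X \<omega> * Y \<omega>)"
  using integrable_power_mult_power[of X Y] by (auto simp: all_moments_def power_mult_distrib)

lemma all_moments_add:
  "all_moments X \<Longrightarrow> all_moments Y \<Longrightarrow> all_moments (\<lambda>\<omega>. X \<omega> + Y \<omega>)"
  using integrable_power_mult_power[of X Y] by (auto simp: all_moments_def binomial_ring mult.assoc)

lemma all_moments_power: "all_moments X \<Longrightarrow> all_moments (\<lambda>\<omega>. X \<omega> ^ n)"
  by (induction n) (auto intro: all_moments_const all_moments_mult)

lemma all_moments_sum_mset:
  "(\<And>x. x \<in># A \<Longrightarrow> all_moments (f x)) \<Longrightarrow> all_moments (\<lambda>\<omega>. \<Sum>x\<in>#A. f x \<omega>)"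
  by (induction A) (auto intro: all_moments_const all_moments_add)

lemma all_moments_imp_integrable: "all_moments X \<Longrightarrow> integrable M X"
  by (auto simp: all_moments_def dest: spec[of _ 1])

lemma all_moments_imp_square_integrable: "all_moments X \<Longrightarrow> square_integrable M X"
  by (auto simp: all_moments_def square_integrable_real_iff)

lemma integral_sum_mset:
  fixes f :: "'k \<Rightarrow> 'a \<Rightarrow> real"
  assumes "\<And>x. x \<in># A \<Longrightarrow> integrable M (f x)"
  shows "(\<integral>\<omega>. (\<Sum>x\<in>#A. f x \<omega>) \<partial>M) = (\<Sum>x\<in>#A. \<integral>\<omega>. f x \<omega> \<partial>M)"
proof -
  have "integrable M (\<lambda>\<omega>. \<Sum>x\<in>#A. f x \<omega>) \<and> ?thesis"
    using assms by (induction A) auto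
  then show ?thesis by blast
qed

text \<open>
  Polarization: the derivative in the direction of \<open>Y\<close> pulls one factor \<open>Y\<close> out of a power. The
  expectation is a polynomial in \<open>s\<close>, so it can be differentiated coefficientwise.
\<close>

lemma has_real_derivative_moment_of_line:
  assumes X: "all_moments X" and Y: "all_moments Y" and Z: "all_moments Z"
  shows "((\<lambda>s. \<integral>\<omega>. (X \<omega> + s * Y \<omega>) ^ n * Z \<omega> \<partial>M) has_real_derivative
      real n * (\<integral>\<omega>. X \<omega> ^ (n - 1) * Y \<omega> * Z \<omega> \<partial>M)) (at 0)"
proof -
  define c where "c j = (\<integral>\<omega>. X \<omega> ^ (n - j) * Y \<omega> ^ j * Z \<omega> \<partial>M)" for j
  have int: "integrable M (\<lambda>\<omega>. X \<omega> ^ (n - j) * Y \<omega> ^ j * Z \<omega>)" for j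
    by (intro all_moments_imp_integrable all_moments_mult all_moments_power X Y Z)
  have expand: "(\<integral>\<omega>. (X \<omega> + s * Y \<omega>) ^ n * Z \<omega> \<partial>M) = (\<Sum>j\<le>n. real (n choose j) * s ^ j * c j)" for s
  proof -
    have "(X \<omega> + s * Y \<omega>) ^ n * Z \<omega>
        = (\<Sum>j\<le>n. real (n choose j) * s ^ j * (X \<omega> ^ (n - j) * Y \<omega> ^ j * Z \<omega>))" for \<omega>
      unfolding add.commute[of "X \<omega>"] binomial_ring
      by (auto simp: sum_distrib_left sum_distrib_right power_mult_distrib ac_simps intro!: sum.cong)
    then show ?thesis using int by (simp add: c_def)
  qed
  have "((\<lambda>s. \<Sum>j\<le>n. real (n choose j) * s ^ j * c j) has_real_derivative
      (\<Sum>j\<le>n. real (n choose j) * (real j * 0 ^ (j - 1)) * c j)) (at 0)"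
    by (auto intro!: derivative_eq_intros sum.cong)
  also have "(\<Sum>j\<le>n. real (n choose j) * (real j * 0 ^ (j - 1)) * c j)
      = (\<Sum>j\<le>n. if j = 1 then real n * c 1 else 0)"
    by (intro sum.cong) (auto simp: power_0_left)
  also have "\<dots> = real n * c 1" by (cases n) auto
  finally show ?thesis unfolding expand by (simp add: c_def)
qed

end

section \<open>Gaussian integration by parts\<close>

locale gaussian_noise = prob_space M for M :: "'a measure" +
  fixes \<xi> :: "'h::{real_inner, polish_space} \<Rightarrow> 'a \<Rightarrow> real"
  assumes white_noise: "white_noise M \<xi>"
begin

lemma noise_measurable[measurable]: "\<xi> h \<in> borel_measurable M"
  and noise_distr: "distr M borel (\<xi> h) = centred_gaussian (norm h)"
  using white_noise by (auto simp: white_noise_def)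

lemma noise_add_scaleR: "AE \<omega> in M. \<xi> (h + s *\<^sub>R k) \<omega> = \<xi> h \<omega> + s * \<xi> k \<omega>"
proof -
  have "\<forall>a b h k. AE \<omega> in M. \<xi> (a *\<^sub>R h + b *\<^sub>R k) \<omega> = a * \<xi> h \<omega> + b * \<xi> k \<omega>"
    using white_noise by (simp add: white_noise_def)
  from this[rule_format, of 1 h s k] show ?thesis by simp
qed

lemma noise_moment:
  "has_bochner_integral M (\<lambda>\<omega>. \<xi> h \<omega> ^ n)
     (if odd n then 0 else fact n / (2 ^ (n div 2) * fact (n div 2)) * (h \<bullet> h) ^ (n div 2))"
  (is "has_bochner_integral M _ ?m")
proof -
  have "has_bochner_integral (centred_gaussian (norm h)) (\<lambda>x. x ^ n) ?m"
  proof (cases "h = 0")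
    case True
    have "integrable (return borel (0::real)) (\<lambda>x. x ^ n)"
      by (subst integrable_iff_bounded) (auto simp: nn_integral_return)
    then have "has_bochner_integral (return borel (0::real)) (\<lambda>x. x ^ n) (0 ^ n)"
      by (auto simp: has_bochner_integral_iff integral_return)
    then show ?thesis using True
      by (cases "n = 0") (auto simp: centred_gaussian_def power_0_left elim!: evenE)
  next
    case False
    then have pos: "norm h > 0" by simp
    have "has_bochner_integral lborel (\<lambda>x. normal_density 0 (norm h) x * x ^ n) ?m"
    proof (cases "odd n")
      case True
      then obtain k where "n = 2 * k + 1" by (auto elim: oddE)
      then show ?thesis using normal_moment_odd[OF pos, of 0 k] True by simp
    next
      case False
      then obtain k where k: "n = 2 * k" by (auto elim: evenE)
      then show ?thesis using normal_moment_even[OF pos, of 0 k] pos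
        by (simp add: power_divide power2_norm_eq_inner field_simps)
    qed
    then show ?thesis using False
      by (auto simp: centred_gaussian_def intro!: has_bochner_integral_density)
  qed
  then show ?thesis
    unfolding noise_distr[symmetric]
    by (auto simp: has_bochner_integral_iff integrable_distr_eq integral_distr)
qed

lemma all_moments_noise: "all_moments (\<xi> h)"
  using noise_moment[of h] by (auto simp: all_moments_def has_bochner_integral_iff)

definition noise_monomial :: "'h multiset \<Rightarrow> 'a \<Rightarrow> real" where
  "noise_monomial G \<omega> = (\<Prod>g\<in>#G. \<xi> g \<omega>)"

lemma noise_monomial_simps[simp]:
  "noise_monomial {#} \<omega> = 1"
  "noise_monomial (add_mset g G) \<omega> = \<xi> g \<omega> * noise_monomial G \<omega>"
  by (auto simp: noise_monomial_def)

lemma all_moments_noise_monomial: "all_moments (noise_monomial G)"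
proof (induction G)
  case empty
  show ?case using all_moments_const[of 1] by (simp add: noise_monomial_def)
next
  case (add g G)
  have "noise_monomial (add_mset g G) = (\<lambda>\<omega>. \<xi> g \<omega> * noise_monomial G \<omega>)" by auto
  then show ?case using all_moments_mult[OF all_moments_noise add] by simp
qed

lemmas all_moments_intros =
  all_moments_const all_moments_mult all_moments_add all_moments_power all_moments_noise
  all_moments_noise_monomial all_moments_sum_mset

lemma integral_noise_line:
  assumes Z: "Z \<in> borel_measurable M"
  shows "(\<integral>\<omega>. \<xi> (h + s *\<^sub>R k) \<omega> ^ n * Z \<omega> \<partial>M) = (\<integral>\<omega>. (\<xi> h \<omega> + s * \<xi> k \<omega>) ^ n * Z \<omega> \<partial>M)"
  using noise_add_scaleR[of h s k] Z
  by (intro integral_cong_AE) (auto elim: eventually_mono)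

text \<open>
  By linearity of the noise, moving \<open>h\<close> along a line in the Hilbert space moves \<open>\<xi> h\<close> along a line.
\<close>

lemma has_real_derivative_noise_moment:
  assumes "all_moments Z"
  shows "((\<lambda>s. \<integral>\<omega>. \<xi> (h + s *\<^sub>R k) \<omega> ^ n * Z \<omega> \<partial>M) has_real_derivative
      real n * (\<integral>\<omega>. \<xi> h \<omega> ^ (n - 1) * \<xi> k \<omega> * Z \<omega> \<partial>M)) (at 0)"
proof -
  have "Z \<in> borel_measurable M" using assms by (simp add: all_moments_def)
  then show ?thesis
    using has_real_derivative_moment_of_line[OF all_moments_noise all_moments_noise assms]
    by (simp add: integral_noise_line)
qed

text \<open>
  The moment \<open>E \<xi>(h)\<^bsup>n+1\<^esup>\<close> is a constant times a power of \<open>h \<bullet> h\<close>. Differentiating this formula along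
  \<open>h + s a\<close> yields \<open>\<xi> a\<close> on the left, and \<open>a \<bullet> h\<close> on the right.
\<close>

lemma gaussian_parts_power:
  "(\<integral>\<omega>. \<xi> h \<omega> ^ n * \<xi> a \<omega> \<partial>M) = real n * (a \<bullet> h) * (\<integral>\<omega>. \<xi> h \<omega> ^ (n - 1) \<partial>M)"
proof -
  have D1: "((\<lambda>s. \<integral>\<omega>. \<xi> (h + s *\<^sub>R a) \<omega> ^ Suc n \<partial>M) has_real_derivative
      real (Suc n) * (\<integral>\<omega>. \<xi> h \<omega> ^ n * \<xi> a \<omega> \<partial>M)) (at 0)"
    using has_real_derivative_noise_moment[OF all_moments_const[of 1], of h a "Suc n"] by simp
  define c where "c = (if odd (Suc n) then 0 else fact (Suc n) / (2 ^ (Suc n div 2) * fact (Suc n div 2)) :: real)"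
  have mom: "(\<integral>\<omega>. \<xi> h \<omega> ^ Suc n \<partial>M) = c * (h \<bullet> h) ^ (Suc n div 2)" for h
    using has_bochner_integral_integral_eq[OF noise_moment[of h "Suc n"]] by (simp add: c_def)
  have sq: "(h + s *\<^sub>R a) \<bullet> (h + s *\<^sub>R a) = h \<bullet> h + s * (2 * (a \<bullet> h)) + s * s * (a \<bullet> a)" for s
    by (simp add: inner_add inner_commute algebra_simps)
  have D2: "((\<lambda>s. \<integral>\<omega>. \<xi> (h + s *\<^sub>R a) \<omega> ^ Suc n \<partial>M) has_real_derivative
      c * (real (Suc n div 2) * (2 * (a \<bullet> h)) * (h \<bullet> h) ^ (Suc n div 2 - 1))) (at 0)"
    unfolding mom sq by (auto intro!: derivative_eq_intros)
  have eq: "real (Suc n) * (\<integral>\<omega>. \<xi> h \<omega> ^ n * \<xi> a \<omega> \<partial>M)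
      = c * (real (Suc n div 2) * (2 * (a \<bullet> h)) * (h \<bullet> h) ^ (Suc n div 2 - 1))"
    by (rule DERIV_unique[OF D1 D2])
  show ?thesis
  proof (cases "even n")
    case True
    then have "(\<integral>\<omega>. \<xi> h \<omega> ^ n * \<xi> a \<omega> \<partial>M) = 0" using eq by (simp add: c_def)
    moreover have "real n * (\<integral>\<omega>. \<xi> h \<omega> ^ (n - 1) \<partial>M) = 0"
      using True has_bochner_integral_integral_eq[OF noise_moment[of h "n - 1"]]
      by (cases "n = 0") auto
    ultimately show ?thesis by auto
  next
    case False
    then obtain q where q: "n = 2 * q + 1" by (auto elim: oddE)
    define r :: real where "r = fact (2 * q) / (2 ^ q * fact q)"
    have n1: "(\<integral>\<omega>. \<xi> h \<omega> ^ (n - 1) \<partial>M) = r * (h \<bullet> h) ^ q"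
      using has_bochner_integral_integral_eq[OF noise_moment[of h "2 * q"]] by (simp add: q r_def)
    have "c = fact (2 * q + 2) / (2 ^ (q + 1) * fact (q + 1))"
      by (simp add: c_def q)
    also have "fact (2 * q + 2) = 2 * (real q + 1) * (real (2 * q + 1) * fact (2 * q))"
      by (simp add: algebra_simps)
    also have "2 ^ (q + 1) * fact (q + 1) = 2 * (real q + 1) * (2 ^ q * fact q)"
      by (simp add: algebra_simps)
    finally have c: "c = real (2 * q + 1) * r"
      by (subst (asm) mult_divide_mult_cancel_left) (auto simp: r_def)
    have "real (2 * q + 2) * (\<integral>\<omega>. \<xi> h \<omega> ^ n * \<xi> a \<omega> \<partial>M)
       = real (2 * q + 2) * (real n * (a \<bullet> h) * (\<integral>\<omega>. \<xi> h \<omega> ^ (n - 1) \<partial>M))"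
      using eq unfolding n1 c by (simp add: q algebra_simps)
    then show ?thesis by simp
  qed
qed

text \<open>
  Wick's formula for one factor \<open>\<xi> a\<close>. Keeping the power of \<open>\<xi> h\<close> makes the induction work: the
  derivative along \<open>h + s g\<close> of the identity for \<open>(n + 1, G)\<close> is \<open>n + 1\<close> times the identity for
  \<open>(n, G + g)\<close>.
\<close>

lemma gaussian_parts_mixed:
  "(\<integral>\<omega>. \<xi> h \<omega> ^ n * (\<xi> a \<omega> * noise_monomial G \<omega>) \<partial>M)
     = real n * (a \<bullet> h) * (\<integral>\<omega>. \<xi> h \<omega> ^ (n - 1) * noise_monomial G \<omega> \<partial>M)
       + (\<Sum>g\<in>#G. (a \<bullet> g) * (\<integral>\<omega>. \<xi> h \<omega> ^ n * noise_monomial (G - {#g#}) \<omega> \<partial>M))"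
proof (induction G arbitrary: h n)
  case empty
  then show ?case using gaussian_parts_power[of h n a] by simp
next
  case (add g G)
  note am = all_moments_intros
  have Eq: "(\<integral>\<omega>. \<xi> (h + s *\<^sub>R g) \<omega> ^ Suc n * (\<xi> a \<omega> * noise_monomial G \<omega>) \<partial>M)
     = real (Suc n) * (a \<bullet> h + s * (a \<bullet> g)) * (\<integral>\<omega>. \<xi> (h + s *\<^sub>R g) \<omega> ^ n * noise_monomial G \<omega> \<partial>M)
       + (\<Sum>g'\<in>#G. (a \<bullet> g') * (\<integral>\<omega>. \<xi> (h + s *\<^sub>R g) \<omega> ^ Suc n * noise_monomial (G - {#g'#}) \<omega> \<partial>M))" for s
    using add.IH[of "h + s *\<^sub>R g" "Suc n"] by (simp add: inner_add_right)
  have D1: "((\<lambda>s. \<integral>\<omega>. \<xi> (h + s *\<^sub>R g) \<omega> ^ Suc n * (\<xi> a \<omega> * noise_monomial G \<omega>) \<partial>M) has_real_derivative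
      real (Suc n) * (\<integral>\<omega>. \<xi> h \<omega> ^ n * \<xi> g \<omega> * (\<xi> a \<omega> * noise_monomial G \<omega>) \<partial>M)) (at 0)"
    using has_real_derivative_noise_moment[of "\<lambda>\<omega>. \<xi> a \<omega> * noise_monomial G \<omega>" h g "Suc n"]
    by (simp add: am)
  \<comment> \<open>The multiset \<open>A\<close> of summation is separated from \<open>G\<close>, so that the induction on \<open>A\<close> leaves the
    summands alone.\<close>
  have D_sum: "((\<lambda>s. \<Sum>g'\<in>#A. (a \<bullet> g') * (\<integral>\<omega>. \<xi> (h + s *\<^sub>R g) \<omega> ^ Suc n * noise_monomial (G - {#g'#}) \<omega> \<partial>M))
     has_real_derivative
      (\<Sum>g'\<in>#A. (a \<bullet> g') * (real (Suc n) * (\<integral>\<omega>. \<xi> h \<omega> ^ n * \<xi> g \<omega> * noise_monomial (G - {#g'#}) \<omega> \<partial>M)))) (at 0)" for A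
  proof (induction A)
    case (add g' A)
    have "((\<lambda>s. \<integral>\<omega>. \<xi> (h + s *\<^sub>R g) \<omega> ^ Suc n * noise_monomial (G - {#g'#}) \<omega> \<partial>M) has_real_derivative
       real (Suc n) * (\<integral>\<omega>. \<xi> h \<omega> ^ n * \<xi> g \<omega> * noise_monomial (G - {#g'#}) \<omega> \<partial>M)) (at 0)"
      using has_real_derivative_noise_moment[of "noise_monomial (G - {#g'#})" h g "Suc n"]
      by (simp add: am)
    from DERIV_add[OF DERIV_cmult[OF this, of "a \<bullet> g'"] add] show ?case by simp
  qed simp
  have D_n: "((\<lambda>s. \<integral>\<omega>. \<xi> (h + s *\<^sub>R g) \<omega> ^ n * noise_monomial G \<omega> \<partial>M) has_real_derivative
       real n * (\<integral>\<omega>. \<xi> h \<omega> ^ (n - 1) * \<xi> g \<omega> * noise_monomial G \<omega> \<partial>M)) (at 0)"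
    by (intro has_real_derivative_noise_moment am)
  have D2: "((\<lambda>s. \<integral>\<omega>. \<xi> (h + s *\<^sub>R g) \<omega> ^ Suc n * (\<xi> a \<omega> * noise_monomial G \<omega>) \<partial>M) has_real_derivative
      real (Suc n) * (a \<bullet> g) * (\<integral>\<omega>. \<xi> h \<omega> ^ n * noise_monomial G \<omega> \<partial>M)
      + real (Suc n) * (a \<bullet> h) * (real n * (\<integral>\<omega>. \<xi> h \<omega> ^ (n - 1) * \<xi> g \<omega> * noise_monomial G \<omega> \<partial>M))
      + (\<Sum>g'\<in>#G. (a \<bullet> g') * (real (Suc n) * (\<integral>\<omega>. \<xi> h \<omega> ^ n * \<xi> g \<omega> * noise_monomial (G - {#g'#}) \<omega> \<partial>M)))) (at 0)"
    unfolding Eq by (rule derivative_eq_intros D_n D_sum refl)+ (simp add: algebra_simps)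
  have G_rest: "add_mset g G - {#g'#} = add_mset g (G - {#g'#})" if "g' \<in># G" for g'
    using that by simp
  have "real (Suc n) * (\<integral>\<omega>. \<xi> h \<omega> ^ n * \<xi> g \<omega> * (\<xi> a \<omega> * noise_monomial G \<omega>) \<partial>M)
      = real (Suc n) * (real n * (a \<bullet> h) * (\<integral>\<omega>. \<xi> h \<omega> ^ (n - 1) * \<xi> g \<omega> * noise_monomial G \<omega> \<partial>M)
        + (a \<bullet> g) * (\<integral>\<omega>. \<xi> h \<omega> ^ n * noise_monomial G \<omega> \<partial>M)
        + (\<Sum>g'\<in>#G. (a \<bullet> g') * (\<integral>\<omega>. \<xi> h \<omega> ^ n * \<xi> g \<omega> * noise_monomial (G - {#g'#}) \<omega> \<partial>M)))"
    unfolding DERIV_unique[OF D1 D2]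
    by (simp only: distrib_left sum_mset_distrib_left) (simp add: ac_simps)
  then have "(\<integral>\<omega>. \<xi> h \<omega> ^ n * \<xi> g \<omega> * (\<xi> a \<omega> * noise_monomial G \<omega>) \<partial>M)
      = real n * (a \<bullet> h) * (\<integral>\<omega>. \<xi> h \<omega> ^ (n - 1) * \<xi> g \<omega> * noise_monomial G \<omega> \<partial>M)
        + (a \<bullet> g) * (\<integral>\<omega>. \<xi> h \<omega> ^ n * noise_monomial G \<omega> \<partial>M)
        + (\<Sum>g'\<in>#G. (a \<bullet> g') * (\<integral>\<omega>. \<xi> h \<omega> ^ n * \<xi> g \<omega> * noise_monomial (G - {#g'#}) \<omega> \<partial>M))"
    by (simp del: of_nat_Suc)
  moreover have "(\<Sum>g'\<in>#G. (a \<bullet> g') * (\<integral>\<omega>. \<xi> h \<omega> ^ n * \<xi> g \<omega> * noise_monomial (G - {#g'#}) \<omega> \<partial>M))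
     = (\<Sum>g'\<in>#G. (a \<bullet> g') * (\<integral>\<omega>. \<xi> h \<omega> ^ n * noise_monomial (add_mset g G - {#g'#}) \<omega> \<partial>M))"
    by (intro arg_cong[where f = sum_mset] image_mset_cong) (simp add: G_rest mult.assoc)
  moreover have "(\<lambda>\<omega>. \<xi> h \<omega> ^ n * \<xi> g \<omega> * (\<xi> a \<omega> * noise_monomial G \<omega>))
      = (\<lambda>\<omega>. \<xi> h \<omega> ^ n * (\<xi> a \<omega> * (\<xi> g \<omega> * noise_monomial G \<omega>)))"
    "(\<lambda>\<omega>. \<xi> h \<omega> ^ (n - 1) * \<xi> g \<omega> * noise_monomial G \<omega>)
      = (\<lambda>\<omega>. \<xi> h \<omega> ^ (n - 1) * (\<xi> g \<omega> * noise_monomial G \<omega>))"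
    by (simp_all only: mult.assoc mult.left_commute[of "\<xi> g _" "\<xi> a _"])
  ultimately show ?case
    by (simp only: noise_monomial_simps sum_mset.insert add_mset_remove_trivial add.assoc)
qed

lemma gaussian_parts_monomial:
  "(\<integral>\<omega>. \<xi> a \<omega> * noise_monomial G \<omega> \<partial>M)
     = (\<integral>\<omega>. (\<Sum>g\<in>#G. (a \<bullet> g) * noise_monomial (G - {#g#}) \<omega>) \<partial>M)"
  using gaussian_parts_mixed[of 0 0 a G]
  by (subst integral_sum_mset) (auto intro!: all_moments_imp_integrable all_moments_intros)

end

section \<open>Hermite polynomials\<close>

text \<open>
  The three-term recurrence gives polynomials that can be differentiated by induction. Their products
  with \<open>exp (- x\<^sup>2 / 2)\<close> are, up to sign, the iterated derivatives that define \<open>hermite\<close>.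
\<close>

fun hermite_rec :: "nat \<Rightarrow> real \<Rightarrow> real" where
  "hermite_rec 0 x = 1"
| "hermite_rec (Suc 0) x = x"
| "hermite_rec (Suc (Suc n)) x = x * hermite_rec (Suc n) x - real (Suc n) * hermite_rec n x"

lemma hermite_rec_Suc: "hermite_rec (Suc n) x = x * hermite_rec n x - real n * hermite_rec (n - 1) x"
  by (cases n) auto

lemma has_real_derivative_hermite_rec:
  "(hermite_rec n has_real_derivative real n * hermite_rec (n - 1) x) (at x)"
proof (induction n rule: less_induct)
  case (less n)
  consider "n = 0" | "n = 1" | k where "n = Suc (Suc k)" by (metis One_nat_def not0_implies_Suc)
  then show ?case
  proof cases
    case 1
    then show ?thesis by (auto simp: fun_eq_iff intro!: derivative_eq_intros)
  next
    case 2
    then show ?thesis by (auto simp: fun_eq_iff intro!: derivative_eq_intros)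
  next
    case 3
    have "((\<lambda>x. x * hermite_rec (Suc k) x - real (Suc k) * hermite_rec k x) has_real_derivative
        (hermite_rec (Suc k) x + x * (real (Suc k) * hermite_rec k x) - real (Suc k) * (real k * hermite_rec (k - 1) x))) (at x)"
      using less.IH[of "Suc k"] less.IH[of k] 3
      by (auto intro!: derivative_eq_intros)
    also have "hermite_rec (Suc k) x + x * (real (Suc k) * hermite_rec k x) - real (Suc k) * (real k * hermite_rec (k - 1) x)
       = real n * hermite_rec (n - 1) x"
    proof -
      have "x * hermite_rec k x = hermite_rec (Suc k) x + real k * hermite_rec (k - 1) x"
        by (simp add: hermite_rec_Suc)
      then have "real (Suc k) * (x * hermite_rec k x)
          = real (Suc k) * (hermite_rec (Suc k) x + real k * hermite_rec (k - 1) x)" by (simp only:)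
      then show ?thesis unfolding 3 by (simp add: algebra_simps)
    qed
    finally show ?thesis unfolding 3 by (simp add: fun_eq_iff[symmetric])
  qed
qed

lemma hermite_eq_hermite_rec: "hermite n x = hermite_rec n x"
proof -
  have "(deriv ^^ n) (\<lambda>t. exp (- (t\<^sup>2 / 2))) = (\<lambda>x. (-1) ^ n * hermite_rec n x * exp (- (x\<^sup>2 / 2)))"
  proof (induction n)
    case (Suc n)
    have "deriv (\<lambda>x. (-1) ^ n * hermite_rec n x * exp (- (x\<^sup>2 / 2))) x
        = (-1) ^ Suc n * hermite_rec (Suc n) x * exp (- (x\<^sup>2 / 2))" for x :: real
      by (rule DERIV_imp_deriv)
        (auto intro!: derivative_eq_intros has_real_derivative_hermite_rec simp: hermite_rec_Suc algebra_simps)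
    then show ?case using Suc by auto
  qed simp
  then show ?thesis
    by (simp add: hermite_def exp_minus field_simps flip: power_mult_distrib)
qed

lemma hermite_0: "hermite 0 x = 1"
  by (simp add: hermite_eq_hermite_rec)

lemma hermite_Suc: "hermite (Suc n) x = x * hermite n x - real n * hermite (n - 1) x"
  by (simp add: hermite_eq_hermite_rec hermite_rec_Suc)

section \<open>Derivatives of polynomials in the noise\<close>

context gaussian_noise begin

text \<open>
  \<open>F'\<close> is the derivative of the polynomial \<open>F\<close> in the direction \<open>a\<close>. It is a relation between random
  variables because a random variable does not determine the polynomial that represents it.
  Generating it from monomials and linear combinations reduces every linear identity to monomials;
  the product rule is then a theorem.
\<close>

inductive noise_deriv :: "'h \<Rightarrow> ('a \<Rightarrow> real) \<Rightarrow> ('a \<Rightarrow> real) \<Rightarrow> bool" for a where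
  monomial: "noise_deriv a (noise_monomial G)
     (\<lambda>\<omega>. \<Sum>g\<in>#G. (a \<bullet> g) * noise_monomial (G - {#g#}) \<omega>)"
| linear: "noise_deriv a F F' \<Longrightarrow> noise_deriv a G G' \<Longrightarrow>
     noise_deriv a (\<lambda>\<omega>. x * F \<omega> + y * G \<omega>) (\<lambda>\<omega>. x * F' \<omega> + y * G' \<omega>)"

lemma noise_deriv_all_moments:
  assumes "noise_deriv a F F'"
  shows "all_moments F" and "all_moments F'"
  using assms by (induction) (auto intro!: all_moments_intros)

lemma gaussian_integration_by_parts:
  assumes "noise_deriv a F F'"
  shows "(\<integral>\<omega>. \<xi> a \<omega> * F \<omega> \<partial>M) = (\<integral>\<omega>. F' \<omega> \<partial>M)"
  using assms
proof induction
  case (monomial G)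
  show ?case by (rule gaussian_parts_monomial)
next
  case (linear F F' G G' x y)
  have i: "integrable M (\<lambda>\<omega>. \<xi> a \<omega> * F \<omega>)" "integrable M (\<lambda>\<omega>. \<xi> a \<omega> * G \<omega>)"
      "integrable M F'" "integrable M G'"
    using noise_deriv_all_moments[OF linear.hyps(1)] noise_deriv_all_moments[OF linear.hyps(2)]
    by (auto intro!: all_moments_imp_integrable all_moments_intros)
  have "(\<lambda>\<omega>. \<xi> a \<omega> * (x * F \<omega> + y * G \<omega>)) = (\<lambda>\<omega>. x * (\<xi> a \<omega> * F \<omega>) + y * (\<xi> a \<omega> * G \<omega>))"
    by (simp add: algebra_simps)
  then show ?case using i linear.IH by simp
qed

lemma noise_deriv_noise_mult:
  assumes "noise_deriv a F F'"
  shows "noise_deriv a (\<lambda>\<omega>. \<xi> h \<omega> * F \<omega>) (\<lambda>\<omega>. (a \<bullet> h) * F \<omega> + \<xi> h \<omega> * F' \<omega>)"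
  using assms
proof induction
  case (monomial G)
  have "(\<Sum>g\<in>#add_mset h G. (a \<bullet> g) * noise_monomial (add_mset h G - {#g#}) \<omega>)
     = (a \<bullet> h) * noise_monomial G \<omega> + \<xi> h \<omega> * (\<Sum>g\<in>#G. (a \<bullet> g) * noise_monomial (G - {#g#}) \<omega>)" for \<omega>
  proof -
    have "(\<Sum>g\<in>#G. (a \<bullet> g) * noise_monomial (add_mset h G - {#g#}) \<omega>)
        = (\<Sum>g\<in>#G. \<xi> h \<omega> * ((a \<bullet> g) * noise_monomial (G - {#g#}) \<omega>))"
      by (intro arg_cong[where f = sum_mset] image_mset_cong) simp
    then show ?thesis by (simp add: sum_mset_distrib_left)
  qed
  moreover have "noise_monomial (add_mset h G) = (\<lambda>\<omega>. \<xi> h \<omega> * noise_monomial G \<omega>)"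
    by auto
  ultimately show ?case using noise_deriv.monomial[of a "add_mset h G"] by simp
next
  case (linear F F' G G' x y)
  show ?case using noise_deriv.linear[OF linear.IH, of x y] by (simp add: algebra_simps)
qed

text \<open>
  A monomial is built up by multiplication with one noise variable at a time, for which the product
  rule is the preceding lemma; both sides are linear in \<open>F\<close>.
\<close>

lemma noise_deriv_mult:
  assumes "noise_deriv a F F'" and G: "noise_deriv a G G'"
  shows "noise_deriv a (\<lambda>\<omega>. F \<omega> * G \<omega>) (\<lambda>\<omega>. F' \<omega> * G \<omega> + F \<omega> * G' \<omega>)"
  using assms(1)
proof induction
  case (monomial H)
  show ?case
  proof (induction H)
    case empty
    show ?case using G by simp
  next
    case (add h H)
    have "(\<Sum>g\<in>#H. (a \<bullet> g) * noise_monomial (add_mset h H - {#g#}) \<omega>)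
        = \<xi> h \<omega> * (\<Sum>g\<in>#H. (a \<bullet> g) * noise_monomial (H - {#g#}) \<omega>)" for \<omega>
      unfolding sum_mset_distrib_left
      by (intro arg_cong[where f = sum_mset] image_mset_cong) simp
    with noise_deriv_noise_mult[OF add, of h] show ?case
      by (simp add: algebra_simps)
  qed
next
  case (linear F F' H H' x y)
  show ?case using noise_deriv.linear[OF linear.IH, of x y] by (simp add: algebra_simps)
qed

end

section \<open>Orthogonality of the Hermite products\<close>

locale noise_basis = gaussian_noise M \<xi>
  for M :: "'a measure" and \<xi> :: "'h::{real_inner, polish_space} \<Rightarrow> 'a \<Rightarrow> real" +
  fixes e :: "nat \<Rightarrow> 'h" and J :: "nat set"
  assumes orthonormal: "i \<in> J \<Longrightarrow> j \<in> J \<Longrightarrow> e i \<bullet> e j = (if i = j then 1 else 0)"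
begin

definition hermite_product :: "nat multiset \<Rightarrow> 'a \<Rightarrow> real" where
  "hermite_product m \<omega> = (\<Prod>l\<in>set_mset m. hermite (count m l) (\<xi> (e l) \<omega>))"

lemma hermite_product_empty[simp]: "hermite_product {#} \<omega> = 1"
  by (simp add: hermite_product_def)

text \<open>
  The recurrence for Hermite polynomials in the coordinate \<open>k\<close>; the other coordinates are spectators.
\<close>

lemma hermite_product_add:
  "hermite_product (add_mset k m) \<omega>
     = \<xi> (e k) \<omega> * hermite_product m \<omega> - real (count m k) * hermite_product (m - {#k#}) \<omega>"
proof -
  define R where "R = (\<Prod>l\<in>set_mset m - {k}. hermite (count m l) (\<xi> (e l) \<omega>))"
  have split: "hermite_product m' \<omega> = hermite (count m' k) (\<xi> (e k) \<omega>) * R"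
    if "set_mset m' \<subseteq> insert k (set_mset m)" and "\<And>l. l \<noteq> k \<Longrightarrow> count m' l = count m l" for m'
  proof -
    have "hermite_product m' \<omega> = (\<Prod>l\<in>insert k (set_mset m). hermite (count m' l) (\<xi> (e l) \<omega>))"
      unfolding hermite_product_def using that(1)
      by (intro prod.mono_neutral_left) (auto simp: hermite_0 not_in_iff)
    also have "\<dots> = hermite (count m' k) (\<xi> (e k) \<omega>) * R"
      unfolding R_def using that(2) by (subst prod.insert_remove) (auto intro!: prod.cong)
    finally show ?thesis .
  qed
  have "set_mset (m - {#k#}) \<subseteq> insert k (set_mset m)" by (auto dest: in_diffD)
  then show ?thesis
    using split[of "add_mset k m"] split[OF subset_insertI] split[of "m - {#k#}"]
    by (auto simp: hermite_Suc algebra_simps)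
qed

text \<open>
  The several-variable form of \<open>H\<^sub>n' = n H\<^bsub>n-1\<^esub>\<close>, by induction along the recurrence. The recurrence refers
  back two degrees, whence the induction on the size.
\<close>

lemma noise_deriv_hermite_product:
  assumes "set_mset m \<subseteq> J" "k \<in> J"
  shows "noise_deriv (e k) (hermite_product m) (\<lambda>\<omega>. real (count m k) * hermite_product (m - {#k#}) \<omega>)"
  using assms(1)
proof (induction m rule: measure_induct_rule[of size])
  case (less m)
  show ?case
  proof (cases m)
    case empty
    have one: "hermite_product {#} = (\<lambda>_. 1)" "noise_monomial {#} = (\<lambda>_. 1)" by auto
    show ?thesis using monomial[of "e k" "{#}"] by (simp add: empty one)
  next
    case (add l m')
    have l: "l \<in> J" and m': "set_mset m' \<subseteq> J" "set_mset (m' - {#l#}) \<subseteq> J"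
      using less.prems add by (auto dest: in_diffD)
    have "size (m' - {#l#}) < size m"
      using size_Diff1_le[of m' l] by (simp add: add)
    then have IH: "noise_deriv (e k) (hermite_product m') (\<lambda>\<omega>. real (count m' k) * hermite_product (m' - {#k#}) \<omega>)"
      "noise_deriv (e k) (hermite_product (m' - {#l#}))
         (\<lambda>\<omega>. real (count (m' - {#l#}) k) * hermite_product (m' - {#l#} - {#k#}) \<omega>)"
      using less.IH[of m'] less.IH[of "m' - {#l#}"] m' by (simp_all add: add)
    have F: "(\<lambda>\<omega>. 1 * (\<xi> (e l) \<omega> * hermite_product m' \<omega>) + (- real (count m' l)) * hermite_product (m' - {#l#}) \<omega>)
        = hermite_product m"
      by (auto simp: add hermite_product_add)
    have "1 * ((e k \<bullet> e l) * hermite_product m' \<omega> + \<xi> (e l) \<omega> * (real (count m' k) * hermite_product (m' - {#k#}) \<omega>))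
         + (- real (count m' l)) * (real (count (m' - {#l#}) k) * hermite_product (m' - {#l#} - {#k#}) \<omega>)
        = real (count m k) * hermite_product (m - {#k#}) \<omega>" for \<omega>
    \<comment> \<open>For \<open>k \<noteq> l\<close> the left-hand side is a multiple of the recurrence that adds \<open>l\<close> to \<open>m' - k\<close>. For
      \<open>k = l\<close> the terms with \<open>m' - k\<close> form that recurrence too, and \<open>e k \<bullet> e l = 1\<close> supplies the additional
      \<open>hermite_product m'\<close> that raises the multiplicity by one.\<close>
    proof (cases "k \<in># m'")
      case False
      then show ?thesis using orthonormal[OF assms(2) l]
        by (auto simp: add not_in_iff)
    next
      case True
      then obtain m'' where m'': "m' = add_mset k m''" by (meson multi_member_split)
      show ?thesis
      proof (cases "k = l")
        case True
        then show ?thesis using orthonormal[OF assms(2) l]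
          by (simp add: add m'' hermite_product_add algebra_simps)
      next
        case False
        have "add_mset l (add_mset k m'') - {#k#} = add_mset l m''"
          by (simp add: add_mset_commute[of l k])
        then show ?thesis using orthonormal[OF assms(2) l] False
          by (simp add: add m'' hermite_product_add algebra_simps)
      qed
    qed
    then show ?thesis
      using noise_deriv.linear[OF noise_deriv_noise_mult[OF IH(1), of "e l"] IH(2), of 1 "- real (count m' l)"]
      unfolding F by simp
  qed
qed

lemma all_moments_hermite_product:
  "set_mset m \<subseteq> J \<Longrightarrow> all_moments (hermite_product m)"
proof (induction m rule: measure_induct_rule[of size])
  case (less m)
  show ?case
  proof (cases m)
    case empty
    then show ?thesis by (simp add: hermite_product_def[abs_def] all_moments_const)
  next
    case (add l m')
    then have "l \<in> J" using less.prems by auto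
    from noise_deriv_all_moments(1)[OF noise_deriv_hermite_product[OF less.prems this]]
    show ?thesis .
  qed
qed

text \<open>
  Adding the index \<open>k\<close> is adjoint to the derivative in the direction \<open>e k\<close>: integration by parts of
  \<open>\<xi>(e\<^sub>k) \<phi>\<^sub>m \<phi>\<^sub>p\<close> produces one term in which \<open>\<phi>\<^sub>m\<close> is differentiated, and the recurrence for \<open>\<phi>\<^bsub>m+k\<^esub>\<close>
  subtracts exactly that term.
\<close>

lemma integral_hermite_product_add:
  assumes m: "set_mset m \<subseteq> J" and p: "set_mset p \<subseteq> J" and k: "k \<in> J"
  shows "(\<integral>\<omega>. hermite_product (add_mset k m) \<omega> * hermite_product p \<omega> \<partial>M)
       = real (count p k) * (\<integral>\<omega>. hermite_product m \<omega> * hermite_product (p - {#k#}) \<omega> \<partial>M)"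
proof -
  have sub: "set_mset (m - {#k#}) \<subseteq> J" "set_mset (p - {#k#}) \<subseteq> J"
    using m p by (auto dest: in_diffD)
  have int: "integrable M (\<lambda>\<omega>. hermite_product m' \<omega> * hermite_product p' \<omega>)"
    "integrable M (\<lambda>\<omega>. \<xi> (e k) \<omega> * (hermite_product m' \<omega> * hermite_product p' \<omega>))"
    if "set_mset m' \<subseteq> J" "set_mset p' \<subseteq> J" for m' p'
    using that by (auto intro!: all_moments_imp_integrable all_moments_intros all_moments_hermite_product)
  let ?A = "\<integral>\<omega>. hermite_product (m - {#k#}) \<omega> * hermite_product p \<omega> \<partial>M"
  let ?B = "\<integral>\<omega>. hermite_product m \<omega> * hermite_product (p - {#k#}) \<omega> \<partial>M"
  have "(\<integral>\<omega>. \<xi> (e k) \<omega> * (hermite_product m \<omega> * hermite_product p \<omega>) \<partial>M)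
     = (\<integral>\<omega>. real (count m k) * hermite_product (m - {#k#}) \<omega> * hermite_product p \<omega>
           + hermite_product m \<omega> * (real (count p k) * hermite_product (p - {#k#}) \<omega>) \<partial>M)"
    by (intro gaussian_integration_by_parts noise_deriv_mult noise_deriv_hermite_product m p k)
  also have "\<dots> = real (count m k) * ?A + real (count p k) * ?B"
    using int[OF sub(1) p] int[OF m sub(2)] by (simp add: mult.assoc mult.left_commute[of "hermite_product m _"])
  finally have parts: "(\<integral>\<omega>. \<xi> (e k) \<omega> * (hermite_product m \<omega> * hermite_product p \<omega>) \<partial>M)
     = real (count m k) * ?A + real (count p k) * ?B" .
  have "(\<lambda>\<omega>. hermite_product (add_mset k m) \<omega> * hermite_product p \<omega>)
     = (\<lambda>\<omega>. \<xi> (e k) \<omega> * (hermite_product m \<omega> * hermite_product p \<omega>)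
          - real (count m k) * (hermite_product (m - {#k#}) \<omega> * hermite_product p \<omega>))"
    by (auto simp: hermite_product_add algebra_simps)
  then show ?thesis using int(1)[OF sub(1) p] int(2)[OF m p] parts by simp
qed

definition mset_fact :: "nat multiset \<Rightarrow> real" where
  "mset_fact m = (\<Prod>l\<in>set_mset m. fact (count m l))"

lemma mset_fact_add: "mset_fact (add_mset k m) = real (Suc (count m k)) * mset_fact m"
proof -
  define R where "R = (\<Prod>l\<in>set_mset m - {k}. fact (count m l) :: real)"
  have "mset_fact (add_mset k m) = fact (Suc (count m k)) * R"
    unfolding mset_fact_def R_def by (simp add: prod.insert_remove)
  moreover have "mset_fact m = fact (count m k) * R"
  proof (cases "k \<in># m")
    case True
    then show ?thesis unfolding mset_fact_def R_def by (subst prod.remove[of _ k]) auto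
  next
    case False
    then show ?thesis unfolding mset_fact_def R_def by (simp add: not_in_iff)
  qed
  ultimately show ?thesis by simp
qed

lemma mset_fact_pos: "mset_fact m > 0"
  by (auto simp: mset_fact_def intro!: prod_pos)

text \<open>
  Moving the indices of \<open>m\<close> one by one to the other factor differentiates \<open>\<phi>\<^sub>p\<close> along \<open>m\<close>. This leaves
  the constant \<open>m!\<close> if \<open>p = m\<close>, and otherwise \<open>0\<close> or a multiple of a \<open>\<phi>\<close> of
  positive degree, which has mean zero.
\<close>

lemma integral_hermite_product_mult:
  assumes "set_mset m \<subseteq> J" "set_mset p \<subseteq> J"
  shows "(\<integral>\<omega>. hermite_product m \<omega> * hermite_product p \<omega> \<partial>M) = (if m = p then mset_fact m else 0)"
  using assms
proof (induction m arbitrary: p)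
  case empty
  show ?case
  proof (cases p)
    case empty
    then show ?thesis by (simp add: prob_space mset_fact_def)
  next
    case (add k p')
    then show ?thesis
      using integral_hermite_product_add[of p' "{#}" k] empty.prems by (simp add: mult.commute)
  qed
next
  case (add k m)
  show ?case
  proof (cases "k \<in># p")
    case True
    then obtain p' where p': "p = add_mset k p'" by (meson multi_member_split)
    then show ?thesis
      using integral_hermite_product_add[of m p k] add.IH[of p'] add.prems by (simp add: mset_fact_add)
  next
    case False
    then show ?thesis
      using integral_hermite_product_add[of m p k] add.prems by (auto simp: not_in_iff)
  qed
qed

end

section \<open>Chaos coefficients and the stochastic derivative\<close>

context noise_basis begin

text \<open>
  By orthogonality only the summand of \<open>m\<close> contributes, and \<open>E(\<phi>\<^sub>m\<^sup>2) = m!\<close> cancels the denominator of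
  its coefficient.
\<close>

lemma noise_polynomial_coefficient:
  assumes P: "noise_polynomial M \<xi> e J n A P" and m: "set_mset m \<subseteq> J"
  shows "(\<integral>\<omega>. hermite_product m \<omega> * P \<omega> \<partial>M)
     = (if size m = n then fact n * A (map e (sorted_list_of_multiset m)) else 0)"
proof -
  define c where "c p = fact n / mset_fact p * A (map e (sorted_list_of_multiset p))" for p
  let ?I = "{p. size p = n \<and> set_mset p \<subseteq> J}"
  have "L2_has_sum M (\<lambda>p \<omega>. c p * hermite_product p \<omega>) ?I P"
    using P unfolding noise_polynomial_def c_def mset_fact_def hermite_product_def .
  then have "((\<lambda>p. \<integral>\<omega>. hermite_product m \<omega> * (c p * hermite_product p \<omega>) \<partial>M)
      has_sum (\<integral>\<omega>. hermite_product m \<omega> * P \<omega> \<partial>M)) ?I"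
    by (rule L2_has_sum_integral_mult)
      (intro all_moments_imp_square_integrable all_moments_hermite_product m)
  moreover have "((\<lambda>p. \<integral>\<omega>. hermite_product m \<omega> * (c p * hermite_product p \<omega>) \<partial>M)
      has_sum (if size m = n then fact n * A (map e (sorted_list_of_multiset m)) else 0)) ?I"
  proof (rule has_sum_finite_neutralI[where B = "?I \<inter> {m}"])
    have eq: "(\<integral>\<omega>. hermite_product m \<omega> * (c p * hermite_product p \<omega>) \<partial>M) = c p * (if m = p then mset_fact m else 0)"
      if "set_mset p \<subseteq> J" for p
      using integral_hermite_product_mult[OF m that] by (simp add: mult.left_commute[of _ "c p"])
    show "(\<integral>\<omega>. hermite_product m \<omega> * (c p * hermite_product p \<omega>) \<partial>M) = 0" if "p \<in> ?I - ?I \<inter> {m}" for p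
      using that eq[of p] by auto
    show "(if size m = n then fact n * A (map e (sorted_list_of_multiset m)) else 0)
        = (\<Sum>p\<in>?I \<inter> {m}. \<integral>\<omega>. hermite_product m \<omega> * (c p * hermite_product p \<omega>) \<partial>M)"
      using m eq[OF m] mset_fact_pos[of m] by (auto simp: c_def)
  qed auto
  ultimately show ?thesis by (rule has_sum_unique)
qed

text \<open>
  The weights \<open>b\<close> cover both the expansion of a random variable, with \<open>b n = 1\<close>, and that of its
  stochastic derivative, with \<open>b n = n + 1\<close>.
\<close>

lemma noise_series_coefficient:
  assumes P: "\<And>n. noise_polynomial M \<xi> e J n (A n) (P n)"
    and X: "L2_has_sum M (\<lambda>n \<omega>. b n * P n \<omega>) UNIV X" and m: "set_mset m \<subseteq> J"
  shows "(\<integral>\<omega>. hermite_product m \<omega> * X \<omega> \<partial>M)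
     = b (size m) * fact (size m) * A (size m) (map e (sorted_list_of_multiset m))"
proof -
  let ?c = "b (size m) * fact (size m) * A (size m) (map e (sorted_list_of_multiset m))"
  have "((\<lambda>n. \<integral>\<omega>. hermite_product m \<omega> * (b n * P n \<omega>) \<partial>M)
      has_sum (\<integral>\<omega>. hermite_product m \<omega> * X \<omega> \<partial>M)) UNIV"
    by (rule L2_has_sum_integral_mult[OF X])
      (intro all_moments_imp_square_integrable all_moments_hermite_product m)
  moreover have "(\<integral>\<omega>. hermite_product m \<omega> * (b n * P n \<omega>) \<partial>M) = (if n = size m then ?c else 0)" for n
    using noise_polynomial_coefficient[OF P m, of n] by (auto simp: mult.left_commute[of _ "b n"])
  moreover have "((\<lambda>n. if n = size m then ?c else 0) has_sum ?c) UNIV"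
    by (rule has_sum_finite_neutralI[where B = "{size m}"]) auto
  ultimately show ?thesis using has_sum_unique by simp blast
qed

text \<open>
  This says that \<open>I(\<phi>\<^sub>m e\<^sub>k) = \<phi>\<^bsub>m+k\<^esub>\<close>. The derivative contributes a factor \<open>n + 1\<close> to \<open>n!\<close>, where \<open>n\<close> is the
  size of \<open>m\<close>; symmetry of the form moves the argument \<open>e k\<close> to its place in the sorted list.
\<close>

lemma stochastic_derivative_coefficient:
  assumes D: "has_stochastic_derivative M \<xi> e J \<gamma> Z" and m: "set_mset m \<subseteq> J" and k: "k \<in> J"
  shows "(\<integral>\<omega>. hermite_product m \<omega> * (Z \<omega> \<bullet> e k) \<partial>M) = (\<integral>\<omega>. hermite_product (add_mset k m) \<omega> * \<gamma> \<omega> \<partial>M)"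
proof -
  obtain A where A: "ito_wiener_expansion M \<xi> e J A \<gamma>"
    and Q: "\<forall>h. \<exists>Q. (\<forall>n. noise_polynomial M \<xi> e J n (\<lambda>xs. A (Suc n) (h # xs)) (Q n)) \<and>
                L2_has_sum M (\<lambda>n \<omega>. real (Suc n) * Q n \<omega>) UNIV (\<lambda>\<omega>. Z \<omega> \<bullet> h)"
    using D unfolding has_stochastic_derivative_def by blast
  obtain Q where Q: "\<And>n. noise_polynomial M \<xi> e J n (\<lambda>xs. A (Suc n) (e k # xs)) (Q n)"
    and QZ: "L2_has_sum M (\<lambda>n \<omega>. real (Suc n) * Q n \<omega>) UNIV (\<lambda>\<omega>. Z \<omega> \<bullet> e k)"
    using Q by blast
  obtain P where P: "\<And>n. noise_polynomial M \<xi> e J n (A n) (P n)" and P\<gamma>: "L2_has_sum M P UNIV \<gamma>"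
    using A unfolding ito_wiener_expansion_def by blast
  have P\<gamma>': "L2_has_sum M (\<lambda>n \<omega>. 1 * P n \<omega>) UNIV \<gamma>" using P\<gamma> by simp
  have sym: "\<And>n xs ys. length xs = n \<Longrightarrow> mset xs = mset ys \<Longrightarrow> A n xs = A n ys"
    using A unfolding ito_wiener_expansion_def symmetric_HS_form_def by blast
  have "A (Suc (size m)) (e k # map e (sorted_list_of_multiset m))
      = A (Suc (size m)) (map e (sorted_list_of_multiset (add_mset k m)))"
    by (rule sym) (simp_all flip: size_mset)
  then show ?thesis
    using noise_series_coefficient[OF Q QZ m] noise_series_coefficient[OF P P\<gamma>', of "add_mset k m"] m k
    by simp
qed

text \<open>
  Two passages to the limit, in the sum over the multisets of one size and in the sum over the
  degrees, carry orthogonality from the \<open>\<phi>\<^sub>m\<close> to \<open>\<gamma>\<close>.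
\<close>

lemma ito_wiener_expansion_orthogonal:
  assumes A: "ito_wiener_expansion M \<xi> e J A \<gamma>" and \<rho>: "square_integrable M \<rho>"
    and orth: "\<And>m. set_mset m \<subseteq> J \<Longrightarrow> (\<integral>\<omega>. hermite_product m \<omega> * \<rho> \<omega> \<partial>M) = 0"
  shows "(\<integral>\<omega>. \<rho> \<omega> * \<gamma> \<omega> \<partial>M) = 0"
proof -
  obtain P where P: "\<And>n. noise_polynomial M \<xi> e J n (A n) (P n)" and P\<gamma>: "L2_has_sum M P UNIV \<gamma>"
    using A unfolding ito_wiener_expansion_def by blast
  have "(\<integral>\<omega>. \<rho> \<omega> * P n \<omega> \<partial>M) = 0" for n
  proof -
    let ?I = "{p. size p = n \<and> set_mset p \<subseteq> J}"
    define c where "c p = fact n / mset_fact p * A n (map e (sorted_list_of_multiset p))" for p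
    have "L2_has_sum M (\<lambda>p \<omega>. c p * hermite_product p \<omega>) ?I (P n)"
      using P[of n] unfolding noise_polynomial_def c_def mset_fact_def hermite_product_def .
    from L2_has_sum_integral_mult[OF this \<rho>]
    have "((\<lambda>p. \<integral>\<omega>. \<rho> \<omega> * (c p * hermite_product p \<omega>) \<partial>M) has_sum (\<integral>\<omega>. \<rho> \<omega> * P n \<omega> \<partial>M)) ?I" .
    moreover have "(\<integral>\<omega>. \<rho> \<omega> * (c p * hermite_product p \<omega>) \<partial>M) = 0" if "p \<in> ?I" for p
    proof -
      have "(\<lambda>\<omega>. \<rho> \<omega> * (c p * hermite_product p \<omega>)) = (\<lambda>\<omega>. c p * (hermite_product p \<omega> * \<rho> \<omega>))"
        by (simp add: ac_simps)
      then show ?thesis using orth[of p] that by simp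
    qed
    ultimately have "((\<lambda>p. 0) has_sum (\<integral>\<omega>. \<rho> \<omega> * P n \<omega> \<partial>M)) ?I"
      by (subst (asm) has_sum_cong[where g = "\<lambda>p. 0"]) auto
    then show ?thesis using has_sum_unique[OF _ has_sum_0] by blast
  qed
  then have "((\<lambda>n::nat. 0) has_sum (\<integral>\<omega>. \<rho> \<omega> * \<gamma> \<omega> \<partial>M)) UNIV"
    using L2_has_sum_integral_mult[OF P\<gamma> \<rho>] by simp
  then show ?thesis using has_sum_unique[OF _ has_sum_0] by blast
qed

section \<open>Centred random variables as extended stochastic integrals\<close>

text \<open>
  The integrand is the series over nonempty \<open>m\<close> of \<open>c\<^sub>m \<phi>\<^bsub>m-k\<^esub> e\<^sub>k\<close>, where \<open>k\<close> is an index chosen from \<open>m\<close>, here the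
  least one. Both this series and the chaos series of \<open>\<beta>\<close> are orthogonal and are paired with \<open>Z\<close> and
  \<open>\<gamma>\<close> term by term.
\<close>

lemma centred_is_extended_stochastic_integral:
  assumes \<beta>: "square_integrable M \<beta>" and centred: "(\<integral>\<omega>. \<beta> \<omega> \<partial>M) = 0"
  shows "\<exists>u. has_extended_stochastic_integral M \<xi> e J u \<beta>"
proof -
  have phi: "square_integrable M (hermite_product m)" if "set_mset m \<subseteq> J" for m
    using that by (intro all_moments_imp_square_integrable all_moments_hermite_product)
  \<comment> \<open>The multisets over \<open>J\<close> are enumerated by the natural numbers that code them; other numbers
    get the empty multiset with coefficient zero.\<close>
  define code :: "nat multiset \<Rightarrow> nat" where "code m = to_nat (sorted_list_of_multiset m)" for m
  define K where "K = {m. set_mset m \<subseteq> J}"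
  have inj: "inj code"
    by (rule injI) (metis code_def mset_sorted_list_of_multiset from_nat_to_nat)
  define \<nu> where "\<nu> i = (if i \<in> code ` K then inv code i else {#})" for i
  have \<nu>_J: "set_mset (\<nu> i) \<subseteq> J" for i
    using inj by (auto simp: \<nu>_def K_def)
  have \<nu>_inj: "\<nu> i \<noteq> \<nu> j" if "i \<in> code ` K" "j \<in> code ` K" "i \<noteq> j" for i j
    using that inj by (auto simp: \<nu>_def)
  define c where "c i = (if i \<in> code ` K then (\<integral>\<omega>. hermite_product (\<nu> i) \<omega> * \<beta> \<omega> \<partial>M) / mset_fact (\<nu> i) else 0)" for i
  \<comment> \<open>The empty multiset has no index to remove. Its coefficient is the mean of \<open>\<beta>\<close>.\<close>
  have c_empty: "c i = 0" if "\<nu> i = {#}" for i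
    using that centred by (simp add: c_def)
  define k where "k i = Min (set_mset (\<nu> i))" for i
  have k_in: "k i \<in># \<nu> i" if "\<nu> i \<noteq> {#}" for i
    unfolding k_def using that by (intro Min_in) auto
  define m where "m i = \<nu> i - {#k i#}" for i
  have m_J: "set_mset (m i) \<subseteq> J" for i
    using \<nu>_J[of i] by (auto simp: m_def dest: in_diffD)
  have \<nu>_add: "\<nu> i = add_mset (k i) (m i)" if "\<nu> i \<noteq> {#}" for i
    using k_in[OF that] by (simp add: m_def)
  \<comment> \<open>The adjoint relation sends \<open>v i\<close> to \<open>t i\<close>; the integrand is the sum of the \<open>v i\<close>, and the sum of
    the \<open>t i\<close> is the projection of \<open>\<beta>\<close> to the chaos space.\<close>
  define t where "t i \<omega> = c i * hermite_product (\<nu> i) \<omega>" for i \<omega>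
  define v where "v i \<omega> = (c i * hermite_product (m i) \<omega>) *\<^sub>R e (k i)" for i \<omega>
  have t: "square_integrable M (t i)" for i
    using square_integrable_scaleR[OF phi[OF \<nu>_J[of i]], of "c i"] by (simp add: t_def[abs_def])
  have v: "square_integrable M (v i)" for i
    using square_integrable_scaleR[OF phi[OF m_J[of i]], of "c i"]
    by (auto simp: v_def[abs_def] square_integrable_def power_mult_distrib intro!: borel_measurable_scaleR)
  have tt: "(\<integral>\<omega>. t i \<omega> * t j \<omega> \<partial>M) = (if i = j then (c i)\<^sup>2 * mset_fact (\<nu> i) else 0)" for i j
  proof -
    have "(\<integral>\<omega>. t i \<omega> * t j \<omega> \<partial>M) = c i * c j * (\<integral>\<omega>. hermite_product (\<nu> i) \<omega> * hermite_product (\<nu> j) \<omega> \<partial>M)"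
      unfolding integral_mult_right_zero[symmetric] by (simp add: t_def ac_simps)
    then show ?thesis
      using integral_hermite_product_mult[OF \<nu>_J \<nu>_J, of i j] \<nu>_inj[of i j]
      by (auto simp: c_def power2_eq_square)
  qed
  have vv: "(\<integral>\<omega>. v i \<omega> \<bullet> v j \<omega> \<partial>M) = (if i = j then (c i)\<^sup>2 * mset_fact (m i) else 0)" for i j
  proof (cases "\<nu> i = {#} \<or> \<nu> j = {#}")
    case True
    then show ?thesis using c_empty by (auto simp: v_def)
  next
    case False
    then have kJ: "k i \<in> J" "k j \<in> J" using k_in \<nu>_J by blast+
    have "(\<integral>\<omega>. v i \<omega> \<bullet> v j \<omega> \<partial>M)
        = c i * c j * (e (k i) \<bullet> e (k j)) * (\<integral>\<omega>. hermite_product (m i) \<omega> * hermite_product (m j) \<omega> \<partial>M)"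
      unfolding integral_mult_right_zero[symmetric] by (simp add: v_def ac_simps)
    also have "\<dots> = c i * c j * (if k i = k j then 1 else 0) * (if m i = m j then mset_fact (m i) else 0)"
      by (simp add: integral_hermite_product_mult[OF m_J m_J] orthonormal[OF kJ])
    also have "\<dots> = (if i = j then (c i)\<^sup>2 * mset_fact (m i) else 0)"
      using \<nu>_inj[of i j] False \<nu>_add[of i] \<nu>_add[of j] by (auto simp: c_def power2_eq_square)
    finally show ?thesis .
  qed
  have sum_t: "summable (\<lambda>i. (c i)\<^sup>2 * mset_fact (\<nu> i))"
  proof -
    have "summable (\<lambda>i. \<integral>\<omega>. (norm (t i \<omega>))\<^sup>2 \<partial>M)"
    proof (rule Bessel_summable[OF \<beta> t])
      show "(\<integral>\<omega>. \<beta> \<omega> \<bullet> t i \<omega> \<partial>M) = (\<integral>\<omega>. (norm (t i \<omega>))\<^sup>2 \<partial>M)" for i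
      proof -
        have "(\<integral>\<omega>. \<beta> \<omega> * t i \<omega> \<partial>M) = c i * (\<integral>\<omega>. hermite_product (\<nu> i) \<omega> * \<beta> \<omega> \<partial>M)"
          unfolding integral_mult_right_zero[symmetric] by (simp add: t_def ac_simps)
        also have "\<dots> = (c i)\<^sup>2 * mset_fact (\<nu> i)"
          using mset_fact_pos[of "\<nu> i"] by (auto simp: c_def power2_eq_square)
        finally show ?thesis using tt[of i i] by (simp add: power2_eq_square)
      qed
    qed (use tt in auto)
    then show ?thesis using tt by (simp add: power2_eq_square)
  qed
  have "norm ((c i)\<^sup>2 * mset_fact (m i)) \<le> (c i)\<^sup>2 * mset_fact (\<nu> i)" for i
  proof (cases "\<nu> i = {#}")
    case False
    \<comment> \<open>Removing an index divides the factorial by a multiplicity, which is at least one.\<close>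
    have "1 * mset_fact (m i) \<le> mset_fact (\<nu> i)"
      unfolding \<nu>_add[OF False] mset_fact_add using mset_fact_pos[of "m i"] by (intro mult_right_mono) auto
    then show ?thesis using mset_fact_pos[of "m i"] by (auto intro: mult_left_mono)
  qed (simp add: c_empty)
  then have "summable (\<lambda>i. (c i)\<^sup>2 * mset_fact (m i))"
    by (intro summable_comparison_test'[OF sum_t])
  then have sum_v: "summable (\<lambda>i. \<integral>\<omega>. (norm (v i \<omega>))\<^sup>2 \<partial>M)"
    using vv by (simp add: power2_norm_eq_inner)
  obtain u where u: "square_integrable M u"
    and u_sums: "\<And>Z. square_integrable M Z \<Longrightarrow> (\<lambda>i. \<integral>\<omega>. Z \<omega> \<bullet> v i \<omega> \<partial>M) sums (\<integral>\<omega>. Z \<omega> \<bullet> u \<omega> \<partial>M)"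
    using orthogonal_series_converges[OF v _ sum_v] vv by auto
  have "summable (\<lambda>i. \<integral>\<omega>. (norm (t i \<omega>))\<^sup>2 \<partial>M)"
    using sum_t tt by (simp add: power2_eq_square)
  then obtain \<beta>' where \<beta>': "square_integrable M \<beta>'"
    and \<beta>'_sums: "\<And>X. square_integrable M X \<Longrightarrow> (\<lambda>i. \<integral>\<omega>. X \<omega> * t i \<omega> \<partial>M) sums (\<integral>\<omega>. X \<omega> * \<beta>' \<omega> \<partial>M)"
    using orthogonal_series_converges[of t, OF t] tt by auto
  have \<rho>: "square_integrable M (\<lambda>\<omega>. \<beta> \<omega> - \<beta>' \<omega>)" by (rule square_integrable_diff[OF \<beta> \<beta>'])
  have \<rho>_orth: "(\<integral>\<omega>. hermite_product p \<omega> * (\<beta> \<omega> - \<beta>' \<omega>) \<partial>M) = 0" if p: "set_mset p \<subseteq> J" for p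
  proof -
    let ?b = "\<integral>\<omega>. hermite_product p \<omega> * \<beta> \<omega> \<partial>M"
    have i: "code p \<in> code ` K" and \<nu>p: "\<nu> (code p) = p" using p inj by (auto simp: K_def \<nu>_def)
    have "(\<integral>\<omega>. hermite_product p \<omega> * t i \<omega> \<partial>M) = (if i = code p then ?b else 0)" for i
    proof -
      have "(\<integral>\<omega>. hermite_product p \<omega> * t i \<omega> \<partial>M) = c i * (\<integral>\<omega>. hermite_product p \<omega> * hermite_product (\<nu> i) \<omega> \<partial>M)"
        unfolding integral_mult_right_zero[symmetric] by (simp add: t_def ac_simps)
      also have "\<dots> = (if i = code p then ?b else 0)"
        using integral_hermite_product_mult[OF p \<nu>_J, of i] \<nu>_inj[of i "code p"] i \<nu>p mset_fact_pos[of p]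
        by (auto simp: c_def)
      finally show ?thesis .
    qed
    then have "(\<lambda>i. if i = code p then ?b else 0) sums (\<integral>\<omega>. hermite_product p \<omega> * \<beta>' \<omega> \<partial>M)"
      using \<beta>'_sums[OF phi[OF p]] by simp
    then have "(\<integral>\<omega>. hermite_product p \<omega> * \<beta>' \<omega> \<partial>M) = ?b"
      using sums_unique2[OF _ sums_single[of "code p" "\<lambda>_. ?b"]] by simp
    then show ?thesis
      using square_integrable_mult[OF phi[OF p] \<beta>] square_integrable_mult[OF phi[OF p] \<beta>']
      by (simp add: right_diff_distrib)
  qed
  have "(\<integral>\<omega>. \<gamma> \<omega> * \<beta> \<omega> \<partial>M) = (\<integral>\<omega>. Z \<omega> \<bullet> u \<omega> \<partial>M)" if D: "has_stochastic_derivative M \<xi> e J \<gamma> Z" for \<gamma> Z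
  proof -
    obtain A where A: "ito_wiener_expansion M \<xi> e J A \<gamma>" and Z: "square_integrable M Z"
      using D unfolding has_stochastic_derivative_def by blast
    have \<gamma>: "square_integrable M \<gamma>"
      using A by (auto simp: ito_wiener_expansion_def L2_has_sum_def)
    have "(\<integral>\<omega>. (\<beta> \<omega> - \<beta>' \<omega>) * \<gamma> \<omega> \<partial>M) = 0"
      by (rule ito_wiener_expansion_orthogonal[OF A \<rho> \<rho>_orth])
    moreover have "(\<lambda>\<omega>. (\<beta> \<omega> - \<beta>' \<omega>) * \<gamma> \<omega>) = (\<lambda>\<omega>. \<gamma> \<omega> * \<beta> \<omega> - \<gamma> \<omega> * \<beta>' \<omega>)"
      by (simp add: algebra_simps)
    ultimately have "(\<integral>\<omega>. \<gamma> \<omega> * \<beta> \<omega> \<partial>M) = (\<integral>\<omega>. \<gamma> \<omega> * \<beta>' \<omega> \<partial>M)"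
      using square_integrable_mult[OF \<gamma> \<beta>] square_integrable_mult[OF \<gamma> \<beta>'] by simp
    moreover have "(\<integral>\<omega>. Z \<omega> \<bullet> v i \<omega> \<partial>M) = (\<integral>\<omega>. \<gamma> \<omega> * t i \<omega> \<partial>M)" for i
    proof (cases "\<nu> i = {#}")
      case False
      then have "k i \<in> J" using k_in \<nu>_J by blast
      have "(\<integral>\<omega>. Z \<omega> \<bullet> v i \<omega> \<partial>M) = c i * (\<integral>\<omega>. hermite_product (m i) \<omega> * (Z \<omega> \<bullet> e (k i)) \<partial>M)"
        unfolding integral_mult_right_zero[symmetric] by (simp add: v_def ac_simps)
      also have "\<dots> = c i * (\<integral>\<omega>. hermite_product (\<nu> i) \<omega> * \<gamma> \<omega> \<partial>M)"
        using stochastic_derivative_coefficient[OF D m_J \<open>k i \<in> J\<close>] \<nu>_add[OF False] by simp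
      also have "\<dots> = (\<integral>\<omega>. \<gamma> \<omega> * t i \<omega> \<partial>M)"
        unfolding integral_mult_right_zero[symmetric] by (simp add: t_def ac_simps)
      finally show ?thesis .
    qed (simp add: v_def t_def c_empty)
    ultimately show ?thesis
      using u_sums[OF Z] \<beta>'_sums[OF \<gamma>] sums_unique2 by simp blast
  qed
  with u \<beta> show ?thesis unfolding has_extended_stochastic_integral_def by blast
qed

end

theorem lemma5:
  fixes M :: "'a measure"
    and \<xi> :: "'h::{real_inner, polish_space} \<Rightarrow> 'a \<Rightarrow> real"
    and e :: "nat \<Rightarrow> 'h" and J :: "nat set"
    and \<alpha> :: "'a \<Rightarrow> real"
  assumes "prob_space M"
    and "white_noise M \<xi>"
    and "sets M = noise_sigma_algebra M \<xi>"
    and "orthonormal_basis e J"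
    and "square_integrable M \<alpha>"
  shows "\<exists>u \<beta>. has_extended_stochastic_integral M \<xi> e J u \<beta> \<and>
           (AE \<omega> in M. \<alpha> \<omega> = (\<integral>\<omega>'. \<alpha> \<omega>' \<partial>M) + \<beta> \<omega>)"
proof -
  interpret prob_space M by fact
  interpret noise_basis M \<xi> e J
    by unfold_locales (use assms in \<open>auto simp: orthonormal_basis_def\<close>)
  define \<beta> where "\<beta> \<omega> = \<alpha> \<omega> - (\<integral>\<omega>'. \<alpha> \<omega>' \<partial>M)" for \<omega>
  have const: "square_integrable M (\<lambda>_. c)" for c :: real
    by (simp add: square_integrable_def)
  have "square_integrable M \<beta>"
    unfolding \<beta>_def by (intro square_integrable_diff assms(5) const)
  moreover have "integrable M \<alpha>"
    using square_integrable_mult[OF assms(5) const[of 1]] by simp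
  then have "(\<integral>\<omega>. \<beta> \<omega> \<partial>M) = 0"
    by (simp add: \<beta>_def prob_space)
  ultimately obtain u where "has_extended_stochastic_integral M \<xi> e J u \<beta>"
    using centred_is_extended_stochastic_integral by blast
  then show ?thesis by (intro exI[of _ u] exI[of _ \<beta>]) (simp add: \<beta>_def)
qed

end
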